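(* Let $w\in S_n$, let $C^L(w)$ be the leaping climbing chain of $w$, and fix any term order on monomials in $x_1,\ldots,x_n$ with $x_1>x_2>\cdots>x_n$. Then the leading monomial of the Schubert polynomial $\mathfrak{S}_w$ is $\mathbf{x}^{\mathrm{wt}(C^L(w),C^L(w))}$.
   Context: Conventions. Permutations are in one-line notation; $t_{ij}$ is the transposition of $i,j$, and $wt_{ij}$ is $w$ with the values in positions $i$ and $j$ exchanged; $s_j=t_{j,j+1}$. $w_0\in S_n$ is the longest permutation, $w_0(k)=n+1-k$. The Bruhat order is the transitive closure of $w\le wt_{ij}$ for $i<j$ with $w(i)<w(j)$; $\lessdot$ denotes its cover relation. $\mathbf{x}^v=\prod_kx_k^{v_k}$. The leading monomial of a polynomial is the largest monomial (without coefficient) appearing in it. Schubert polynomials. With $\partial_j(f)=\frac{f-s_j\cdot f}{x_j-x_{j+1}}$ on $\mathbb{Z}[x_1,\ldots,x_n]$ ($s_j$ exchanging $x_j$ and $x_{j+1}$), $\mathfrak{S}_{w_0}=x_1^{n-1}x_2^{n-2}\cdots x_{n-1}$ and $\mathfrak{S}_w=\partial_j\mathfrak{S}_{ws_j}$ whenever $w(j)<w(j+1)$. Leaping chain. For $w\ne w_0$ set $a=\min\{k\mid w(k)\ne n+1-k\}$, $b=\min\{k\mid k>a\text{ and }w\lessdot wt_{ak}\}$, and $\mathrm{leap}(w)=(a,b)$. $C^L(w_0)$ is the empty sequence; for $w\neq w_0$ with $\mathrm{leap}(w)=(a,b)$, $C^L(w)$ is obtained by prepending $(a,b)$ to $C^L(wt_{ab})$.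 Weight. For such a sequence $C$ of pairs (links), with all links marked, $\mathrm{wt}(C,C)\in\mathbb{Z}^n$ is the vector with $\mathrm{wt}(C,C)_k=n-k-\#\{\text{links of the form }(k,\star)\text{ in }C\}$. *)

theory Defs
  imports "HOL-Combinatorics.Permutations" "HOL-Library.Poly_Mapping"
begin

text \<open>
  An element of \<open>S\<^sub>n\<close> is a function \<open>w\<close> on \<^typ>\<open>nat\<close> with \<open>w permutes {1..n}\<close>.  Hence
  \<open>w \<circ> transpose i j\<close> is \<open>w\<close> with the values in positions \<open>i\<close> and \<open>j\<close> exchanged.
\<close>

definition longest_perm :: "nat \<Rightarrow> nat \<Rightarrow> nat" where
  "longest_perm n k = (if k \<in> {1..n} then n + 1 - k else k)"


subsection \<open>Bruhat order\<close>

definition bruhat_step :: "nat \<Rightarrow> (nat \<Rightarrow> nat) \<Rightarrow> (nat \<Rightarrow> nat) \<Rightarrow> bool" where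
  "bruhat_step n u v \<longleftrightarrow>
     (\<exists>i j. 1 \<le> i \<and> i < j \<and> j \<le> n \<and> u i < u j \<and> v = u \<circ> transpose i j)"

definition bruhat_less :: "nat \<Rightarrow> (nat \<Rightarrow> nat) \<Rightarrow> (nat \<Rightarrow> nat) \<Rightarrow> bool" where
  "bruhat_less n = (bruhat_step n)\<^sup>+\<^sup>+"

definition bruhat_covers :: "nat \<Rightarrow> (nat \<Rightarrow> nat) \<Rightarrow> (nat \<Rightarrow> nat) \<Rightarrow> bool" where
  "bruhat_covers n u v \<longleftrightarrow>
     bruhat_less n u v \<and> \<not> (\<exists>z. bruhat_less n u z \<and> bruhat_less n z v)"


subsection \<open>Polynomials and Schubert polynomials\<close>

text \<open>
  A monomial is its finitely supported exponent vector, a polynomial maps monomials to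
  integer coefficients.  The variables are \<open>x\<^sub>i\<close> for all natural numbers \<open>i\<close>; the ring
  \<open>\<int>[x\<^sub>1, \<dots>, x\<^sub>n]\<close> consists of the polynomials whose monomials all lie in \<open>monomials n\<close>.
\<close>

type_synonym monomial = "nat \<Rightarrow>\<^sub>0 nat"
type_synonym mpoly = "monomial \<Rightarrow>\<^sub>0 int"

definition monomials :: "nat \<Rightarrow> monomial set" where
  "monomials n = {m. Poly_Mapping.keys m \<subseteq> {1..n}}"

definition x_var :: "nat \<Rightarrow> mpoly" where
  "x_var i = Poly_Mapping.single (Poly_Mapping.single i 1) 1"

definition swap_vars :: "nat \<Rightarrow> mpoly \<Rightarrow> mpoly" where
  "swap_vars j f = Poly_Mapping.map_key (Poly_Mapping.map_key (transpose j (j + 1))) f"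

text \<open>The polynomial ring is an integral domain, so the exact quotient is unique.\<close>

definition divided_difference :: "nat \<Rightarrow> mpoly \<Rightarrow> mpoly" where
  "divided_difference j f = (THE g. g * (x_var j - x_var (j + 1)) = f - swap_vars j f)"

definition schubert_family :: "nat \<Rightarrow> ((nat \<Rightarrow> nat) \<Rightarrow> mpoly) \<Rightarrow> bool" where
  "schubert_family n S \<longleftrightarrow>
     S (longest_perm n) = (\<Prod>k=1..n. x_var k ^ (n - k)) \<and>
     (\<forall>w j. w permutes {1..n} \<and> 1 \<le> j \<and> j < n \<and> w j < w (j + 1) \<longrightarrow>
        S w = divided_difference j (S (w \<circ> transpose j (j + 1))))"

text \<open>
  The divided differences satisfy the braid relations, so a family as above exists, and its
  values on \<open>S\<^sub>n\<close> are uniquely determined; the values outside \<open>S\<^sub>n\<close> are irrelevant.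
\<close>

definition schubert :: "nat \<Rightarrow> (nat \<Rightarrow> nat) \<Rightarrow> mpoly" where
  "schubert n = (SOME S. schubert_family n S)"


subsection \<open>Leaping chain and its weight\<close>

definition leap :: "nat \<Rightarrow> (nat \<Rightarrow> nat) \<Rightarrow> nat \<times> nat" where
  "leap n w =
     (let a = (LEAST k. k \<in> {1..n} \<and> w k \<noteq> n + 1 - k);
          b = (LEAST k. k \<in> {1..n} \<and> a < k \<and> bruhat_covers n w (w \<circ> transpose a k))
      in (a, b))"

inductive is_leaping_chain :: "nat \<Rightarrow> (nat \<Rightarrow> nat) \<Rightarrow> (nat \<times> nat) list \<Rightarrow> bool" for n where
  longest: "is_leaping_chain n (longest_perm n) []"
| leap: "w \<noteq> longest_perm n \<Longrightarrow> leap n w = (a, b) \<Longrightarrow>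
    is_leaping_chain n (w \<circ> transpose a b) C \<Longrightarrow> is_leaping_chain n w ((a, b) # C)"

text \<open>
  The relation is deterministic, and for \<open>w\<close> in \<open>S\<^sub>n\<close> the recursion ends because every leap is a
  Bruhat cover.
\<close>

definition leaping_chain :: "nat \<Rightarrow> (nat \<Rightarrow> nat) \<Rightarrow> (nat \<times> nat) list" where
  "leaping_chain n w = (THE C. is_leaping_chain n w C)"

text \<open>
  The weight of a chain all of whose links are marked.  Links are counted as entries of the
  list, and the entries of the weight are a priori integers.
\<close>

definition weight :: "nat \<Rightarrow> (nat \<times> nat) list \<Rightarrow> nat \<Rightarrow> int" where
  "weight n C k = int n - int k - int (length (filter (\<lambda>l. fst l = k) C))"

text \<open>The monomial \<open>x\<^sup>v\<close>; meaningful only if \<open>v k \<ge> 0\<close> for all \<open>k\<close> in \<open>{1..n}\<close>.\<close>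

definition monomial_of :: "nat \<Rightarrow> (nat \<Rightarrow> int) \<Rightarrow> monomial" where
  "monomial_of n v = (\<Sum>k=1..n. Poly_Mapping.single k (nat (v k)))"


subsection \<open>Term orders and leading monomials\<close>

text \<open>
  \<open>(p, q) \<in> R\<close> means that \<open>p\<close> is at most \<open>q\<close>; the product of monomials is the sum of exponent
  vectors, and the monomial 1 is the zero vector.
\<close>

definition term_order :: "nat \<Rightarrow> monomial rel \<Rightarrow> bool" where
  "term_order n R \<longleftrightarrow>
     linear_order_on (monomials n) R \<and>
     (\<forall>p\<in>monomials n. (0, p) \<in> R) \<and>
     (\<forall>p q. (p, q) \<in> R \<longrightarrow> (\<forall>r\<in>monomials n. (p + r, q + r) \<in> R))"

definition is_leading_monomial :: "monomial rel \<Rightarrow> mpoly \<Rightarrow> monomial \<Rightarrow> bool" where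
  "is_leading_monomial R f m \<longleftrightarrow>
     m \<in> Poly_Mapping.keys f \<and> (\<forall>p\<in>Poly_Mapping.keys f. (p, m) \<in> R)"

end

theory Submission
  imports Defs
begin

text \<open>
  Let \<open>a\<close> be the first position with \<open>w(a) \<noteq> n + 1 - a\<close>.  No upward cover of \<open>w\<close> exchanges \<open>a\<close> with
  an earlier position, so Monk's rule reduces to the co-transition formula: \<open>x\<^sub>a\<close> times the Schubert
  polynomial of \<open>w\<close> is the sum of those of the covers \<open>w t\<^sub>a\<^sub>b\<close>.  We take this formula as the
  definition of a family of polynomials with nonnegative coefficients and show, by induction down
  the Bruhat order, that the family is compatible with the divided differences.

  Since nothing cancels, the leading monomial of \<open>w\<close> is, up to the factor \<open>x\<^sub>a\<close>, the largest one
  among those of the covers.  Let \<open>c\<^sub>j\<close> count the positions \<open>i < j\<close> with \<open>w(i) > w(j)\<close>.  Passing to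
  \<open>w t\<^sub>a\<^sub>b\<close> only raises \<open>c\<^sub>b\<close>, by one, where \<open>c\<^sub>b \<ge> a - 1\<close> with equality at the leap.  Hence the partition
  conjugate to \<open>c\<close> gains a box in row \<open>c\<^sub>b + 1 \<ge> a\<close>, and the leap is the choice that is maximal in
  dominance order, which every term order with \<open>x\<^sub>1 > \<dots> > x\<^sub>n\<close> refines.
\<close>

subsection \<open>Polynomials and exchange of variables\<close>

lemma poly_mapping_eq_sum_single:
  "f = (\<Sum>m\<in>Poly_Mapping.keys f. Poly_Mapping.single m (Poly_Mapping.lookup f m))"
proof (rule poly_mapping_eqI)
  fix k
  show "Poly_Mapping.lookup f k =
      Poly_Mapping.lookup (\<Sum>m\<in>Poly_Mapping.keys f. Poly_Mapping.single m (Poly_Mapping.lookup f m)) k"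
    by (cases "k \<in> Poly_Mapping.keys f")
      (simp_all add: lookup_sum lookup_single when_def not_in_keys_iff_lookup_eq_zero)
qed

definition swap_exponents :: "nat \<Rightarrow> monomial \<Rightarrow> monomial" where
  "swap_exponents j m = Poly_Mapping.map_key (transpose j (j + 1)) m"

lemma lookup_swap_exponents:
  "Poly_Mapping.lookup (swap_exponents j m) k = Poly_Mapping.lookup m (transpose j (j + 1) k)"
  unfolding swap_exponents_def by (simp add: map_key.rep_eq)

lemma swap_exponents_involutory [simp]: "swap_exponents j (swap_exponents j m) = m"
  by (rule poly_mapping_eqI) (simp add: lookup_swap_exponents)

lemma inj_swap_exponents: "inj (swap_exponents j)"
  by (rule inj_on_inverseI[where g = "swap_exponents j"]) simp

lemma swap_exponents_add: "swap_exponents j (m + m') = swap_exponents j m + swap_exponents j m'"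
  by (rule poly_mapping_eqI) (simp add: lookup_swap_exponents lookup_add)

lemma swap_exponents_zero [simp]: "swap_exponents j 0 = 0"
  by (rule poly_mapping_eqI) (simp add: lookup_swap_exponents)

lemma swap_exponents_single:
  "swap_exponents j (Poly_Mapping.single i c) = Poly_Mapping.single (transpose j (j + 1) i) c"
proof -
  have "swap_exponents j (Poly_Mapping.single (transpose j (j + 1) (transpose j (j + 1) i)) c) =
      Poly_Mapping.single (transpose j (j + 1) i) c"
    unfolding swap_exponents_def by (rule map_key_single) simp
  then show ?thesis by simp
qed

lemma lookup_swap_vars:
  "Poly_Mapping.lookup (swap_vars j f) m = Poly_Mapping.lookup f (swap_exponents j m)"
proof -
  have eq: "Poly_Mapping.map_key (transpose j (j + 1)) = swap_exponents j"
    by (simp add: fun_eq_iff swap_exponents_def)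
  show ?thesis
    unfolding swap_vars_def eq by (simp add: map_key.rep_eq[OF inj_swap_exponents])
qed

lemma swap_vars_involutory [simp]: "swap_vars j (swap_vars j f) = f"
  by (rule poly_mapping_eqI) (simp add: lookup_swap_vars)

lemma swap_vars_single:
  "swap_vars j (Poly_Mapping.single m c) = Poly_Mapping.single (swap_exponents j m) c"
  by (rule poly_mapping_eqI)
    (metis lookup_single_eq lookup_single_not_eq lookup_swap_vars swap_exponents_involutory)

lemma swap_vars_zero [simp]: "swap_vars j 0 = 0"
  by (rule poly_mapping_eqI) (simp add: lookup_swap_vars)

lemma swap_vars_one [simp]: "swap_vars j 1 = 1"
  using swap_vars_single[of j 0 1] by simp

lemma swap_vars_add: "swap_vars j (f + g) = swap_vars j f + swap_vars j g"
  by (rule poly_mapping_eqI) (simp add: lookup_swap_vars lookup_add)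

lemma swap_vars_diff: "swap_vars j (f - g) = swap_vars j f - swap_vars j g"
  by (rule poly_mapping_eqI) (simp add: lookup_swap_vars lookup_minus)

lemma swap_vars_sum: "swap_vars j (\<Sum>i\<in>A. f i) = (\<Sum>i\<in>A. swap_vars j (f i))"
  by (rule poly_mapping_eqI) (simp add: lookup_swap_vars lookup_sum)

text \<open>Both factors are expanded into single terms, where multiplicativity is additivity of the
  exchange on exponent vectors.\<close>

lemma swap_vars_mult: "swap_vars j (f * g) = swap_vars j f * swap_vars j g"
proof -
  let ?s = "\<lambda>f m. Poly_Mapping.single m (Poly_Mapping.lookup f m) :: mpoly"
  let ?K = "Poly_Mapping.keys"
  have "f * g = (\<Sum>m\<in>?K f. \<Sum>m'\<in>?K g. ?s f m * ?s g m')"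
    using poly_mapping_eq_sum_single[of f] poly_mapping_eq_sum_single[of g]
    by (metis (no_types, lifting) sum.cong sum_product)
  then have "swap_vars j (f * g) = (\<Sum>m\<in>?K f. \<Sum>m'\<in>?K g. swap_vars j (?s f m) * swap_vars j (?s g m'))"
    by (simp add: swap_vars_sum swap_vars_single mult_single swap_exponents_add)
  also have "\<dots> = swap_vars j (\<Sum>m\<in>?K f. ?s f m) * swap_vars j (\<Sum>m\<in>?K g. ?s g m)"
    by (simp add: swap_vars_sum sum_product)
  finally show ?thesis
    using poly_mapping_eq_sum_single[of f] poly_mapping_eq_sum_single[of g] by simp
qed

lemma swap_vars_power: "swap_vars j (f ^ k) = swap_vars j f ^ k"
  by (induction k) (simp_all add: swap_vars_mult)

lemma swap_vars_prod: "swap_vars j (\<Prod>i\<in>A. f i) = (\<Prod>i\<in>A. swap_vars j (f i))"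
  by (induction A rule: infinite_finite_induct) (simp_all add: swap_vars_mult)

lemma swap_vars_x_var: "swap_vars j (x_var i) = x_var (transpose j (j + 1) i)"
  by (simp add: x_var_def swap_vars_single swap_exponents_single)

lemma swap_vars_x_var_cases [simp]:
  "swap_vars j (x_var j) = x_var (j + 1)"
  "swap_vars j (x_var (j + 1)) = x_var j"
  "i \<noteq> j \<Longrightarrow> i \<noteq> j + 1 \<Longrightarrow> swap_vars j (x_var i) = x_var i"
  by (simp_all add: swap_vars_x_var)

lemma swap_vars_commute:
  assumes "i + 1 < j"
  shows "swap_vars i (swap_vars j f) = swap_vars j (swap_vars i f)"
proof (rule poly_mapping_eqI)
  fix m
  have "swap_exponents j (swap_exponents i m) = swap_exponents i (swap_exponents j m)"
    using assms by (intro poly_mapping_eqI) (auto simp: lookup_swap_exponents transpose_def)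
  then show "Poly_Mapping.lookup (swap_vars i (swap_vars j f)) m =
      Poly_Mapping.lookup (swap_vars j (swap_vars i f)) m"
    by (simp add: lookup_swap_vars)
qed

lemma swap_vars_braid:
  "swap_vars i (swap_vars (i + 1) (swap_vars i f)) =
   swap_vars (i + 1) (swap_vars i (swap_vars (i + 1) f))"
proof (rule poly_mapping_eqI)
  fix m
  have "swap_exponents i (swap_exponents (i + 1) (swap_exponents i m)) =
      swap_exponents (i + 1) (swap_exponents i (swap_exponents (i + 1) m))"
    by (intro poly_mapping_eqI) (auto simp: lookup_swap_exponents transpose_def)
  then show "Poly_Mapping.lookup (swap_vars i (swap_vars (i + 1) (swap_vars i f))) m =
      Poly_Mapping.lookup (swap_vars (i + 1) (swap_vars i (swap_vars (i + 1) f))) m"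
    by (simp add: lookup_swap_vars)
qed

lemma x_var_nonzero [simp]: "x_var i \<noteq> 0"
  by (metis lookup_single_eq lookup_zero x_var_def zero_neq_one)

lemma x_var_inject [simp]: "x_var i = x_var j \<longleftrightarrow> i = j"
  unfolding x_var_def
  by (metis lookup_single_eq lookup_single_not_eq zero_neq_one)

text \<open>Cancellation in an integral domain makes the quotient unique, so every later claim about
  divided differences can be an identity without division.\<close>

lemma divided_difference_eqI:
  assumes "g * (x_var j - x_var (j + 1)) = f - swap_vars j f"
  shows "divided_difference j f = g"
  unfolding divided_difference_def
proof (rule the_equality)
  fix h assume "h * (x_var j - x_var (j + 1)) = f - swap_vars j f"
  then have "h * (x_var j - x_var (j + 1)) = g * (x_var j - x_var (j + 1))" using assms by simp
  then show "h = g" by simp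
qed (fact assms)

text \<open>The exchange negates both the numerator \<open>f - swap_vars j f\<close> and the
  divisor.\<close>

lemma symmetric_divided_difference:
  assumes "g * (x_var j - x_var (j + 1)) = f - swap_vars j f"
  shows "swap_vars j g = g"
proof -
  have "swap_vars j g * (x_var (j + 1) - x_var j) = swap_vars j f - f"
    using arg_cong[OF assms, of "swap_vars j"]
    by (simp only: swap_vars_mult swap_vars_diff swap_vars_x_var_cases swap_vars_involutory)
  also have "\<dots> = - (g * (x_var j - x_var (j + 1)))"
    by (simp only: assms minus_diff_eq)
  also have "\<dots> = g * (x_var (j + 1) - x_var j)"
    by (simp add: algebra_simps)
  finally show ?thesis by simp
qed

section \<open>Exact division by a variable\<close>

definition divide_x_var :: "nat \<Rightarrow> mpoly \<Rightarrow> mpoly" where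
  "divide_x_var a f = Poly_Mapping.map_key (\<lambda>m. m + Poly_Mapping.single a 1) f"

lemma lookup_divide_x_var:
  "Poly_Mapping.lookup (divide_x_var a f) m = Poly_Mapping.lookup f (m + Poly_Mapping.single a 1)"
  unfolding divide_x_var_def by (subst map_key.rep_eq) (auto simp: inj_def)

lemma x_var_mult_single:
  "x_var a * Poly_Mapping.single m c = Poly_Mapping.single (m + Poly_Mapping.single a 1) c"
  by (simp add: x_var_def mult_single add.commute)

lemma divide_x_var_x_var_mult: "divide_x_var a (x_var a * f) = f"
proof -
  have "divide_x_var a (x_var a * f) = divide_x_var a (\<Sum>m\<in>Poly_Mapping.keys f.
      Poly_Mapping.single (m + Poly_Mapping.single a 1) (Poly_Mapping.lookup f m))"
    using poly_mapping_eq_sum_single[of f]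
    by (metis (no_types, lifting) sum.cong sum_distrib_left x_var_mult_single)
  also have "\<dots> = f"
    by (rule poly_mapping_eqI)
      (simp add: lookup_divide_x_var lookup_sum lookup_single when_def not_in_keys_iff_lookup_eq_zero)
  finally show ?thesis .
qed

lemma x_var_mult_divide_x_var:
  assumes "\<And>m. m \<in> Poly_Mapping.keys f \<Longrightarrow> 0 < Poly_Mapping.lookup m a"
  shows "x_var a * divide_x_var a f = f"
proof -
  let ?e = "Poly_Mapping.single a (1::nat)"
  \<comment> \<open>Subtraction of exponents is truncated; the assumption that \<open>x_a\<close>
    occurs in \<open>m\<close> makes it reversible.\<close>
  have *: "m - ?e + ?e = m" if "m \<in> Poly_Mapping.keys f" for m
    using assms[OF that]
    by (intro poly_mapping_eqI) (auto simp: lookup_add lookup_minus lookup_single when_def)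
  have "f = (\<Sum>m\<in>Poly_Mapping.keys f. Poly_Mapping.single (m - ?e + ?e) (Poly_Mapping.lookup f m))"
    by (subst (1) poly_mapping_eq_sum_single[of f]) (intro sum.cong refl, simp only: *)
  also have "\<dots> = x_var a * (\<Sum>m\<in>Poly_Mapping.keys f. Poly_Mapping.single (m - ?e) (Poly_Mapping.lookup f m))"
    by (simp add: sum_distrib_left x_var_mult_single)
  finally show ?thesis
    by (metis divide_x_var_x_var_mult)
qed

subsection \<open>The co-transition family\<close>

lemma permutes_swap:
  assumes "w permutes {1..n}" "1 \<le> a" "a \<le> n" "1 \<le> b" "b \<le> n"
  shows "w \<circ> transpose a b permutes {1..n}"
  using assms by (intro permutes_compose permutes_swap_id) auto

lemma permutes_range:
  assumes "w permutes {1..n}" "1 \<le> k" "k \<le> n"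
  shows "1 \<le> w k" "w k \<le> n"
  using permutes_in_image[OF assms(1), of k] assms(2,3) by auto

lemma permutes_eq_iff: "w permutes A \<Longrightarrow> w i = w j \<longleftrightarrow> i = j"
  by (metis permutes_inj injD)

text \<open>Strictly decreasing along the Bruhat order, hence an induction measure that replaces the length.\<close>

definition position_sum :: "nat \<Rightarrow> (nat \<Rightarrow> nat) \<Rightarrow> nat" where
  "position_sum n w = (\<Sum>k=1..n. k * w k)"

text \<open>Rearrangement inequality: the two sums differ by
  \<open>(b - a) * (w b - w a)\<close>.\<close>

lemma position_sum_swap_less:
  assumes "1 \<le> a" "a < b" "b \<le> n" "w a < w b"
  shows "position_sum n (w \<circ> transpose a b) < position_sum n w"
proof -
  let ?C = "{1..n} - {a} - {b}"
  have split: "position_sum n v = a * v a + (b * v b + (\<Sum>k\<in>?C. k * v k))" for v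
    unfolding position_sum_def using assms
    by (subst sum.remove[of _ a], simp, simp, subst sum.remove[of _ b], simp_all)
  have "(\<Sum>k\<in>?C. k * (w \<circ> transpose a b) k) = (\<Sum>k\<in>?C. k * w k)"
    by (intro sum.cong) (auto simp: transpose_def)
  moreover have "a * w b + b * w a < a * w a + b * w b"
  proof -
    obtain d e where "b = a + d" "0 < d" "w b = w a + e" "0 < e"
      using assms(2,4) by (metis less_imp_add_positive)
    then show ?thesis by (simp add: algebra_simps)
  qed
  ultimately show ?thesis
    unfolding split[of w] split[of "w \<circ> transpose a b"] by simp
qed

section \<open>First defect and climbs of a permutation\<close>

definition first_defect :: "nat \<Rightarrow> (nat \<Rightarrow> nat) \<Rightarrow> nat" where
  "first_defect n w = (LEAST k. k \<in> {1..n} \<and> w k \<noteq> n + 1 - k)"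

text \<open>An order-free description of upward Bruhat covers exchanging \<open>a\<close> with a
  later position; \<open>bruhat_covers_climb\<close> provides the link to the order.\<close>

definition climbs :: "nat \<Rightarrow> (nat \<Rightarrow> nat) \<Rightarrow> nat \<Rightarrow> nat set" where
  "climbs n w a =
     {b. a < b \<and> b \<le> n \<and> w a < w b \<and> (\<forall>k. a < k \<and> k < b \<longrightarrow> \<not> (w a < w k \<and> w k < w b))}"

lemma finite_climbs [simp]: "finite (climbs n w a)"
  by (rule finite_subset[of _ "{..n}"]) (auto simp: climbs_def)

lemma climbsD:
  assumes "b \<in> climbs n w a"
  shows "a < b" "b \<le> n" "w a < w b"
  using assms by (auto simp: climbs_def)

lemma longest_permI:
  assumes "w permutes {1..n}" "\<And>k. 1 \<le> k \<Longrightarrow> k \<le> n \<Longrightarrow> w k = n + 1 - k"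
  shows "w = longest_perm n"
  using assms permutes_not_in[OF assms(1)] by (fastforce simp: longest_perm_def fun_eq_iff)

context
  fixes n :: nat and w :: "nat \<Rightarrow> nat"
  assumes perm: "w permutes {1..n}" and ne: "w \<noteq> longest_perm n"
begin

lemma first_defect_in: "1 \<le> first_defect n w" "first_defect n w \<le> n"
  and first_defect_neq: "w (first_defect n w) \<noteq> n + 1 - first_defect n w"
proof -
  have "\<exists>k. k \<in> {1..n} \<and> w k \<noteq> n + 1 - k"
    using longest_permI[OF perm] ne by auto
  from LeastI_ex[OF this] show "1 \<le> first_defect n w" "first_defect n w \<le> n"
    "w (first_defect n w) \<noteq> n + 1 - first_defect n w"
    by (auto simp: first_defect_def)
qed

lemma before_first_defect:
  assumes "1 \<le> k" "k < first_defect n w"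
  shows "w k = n + 1 - k"
proof (rule ccontr)
  assume "w k \<noteq> n + 1 - k"
  moreover have "k \<le> n" using assms first_defect_in by simp
  ultimately have "first_defect n w \<le> k"
    unfolding first_defect_def using assms(1) by (intro Least_le) auto
  then show False using assms(2) by simp
qed

text \<open>All values above \<open>n + 1 - a\<close> are already taken by the positions before the
  first defect \<open>a\<close>.\<close>

lemma from_first_defect:
  assumes "first_defect n w \<le> k" "k \<le> n"
  shows "w k \<le> n + 1 - first_defect n w"
proof (rule ccontr)
  assume gt: "\<not> w k \<le> n + 1 - first_defect n w"
  have "1 \<le> k" using assms(1) first_defect_in by simp
  then have "w k \<le> n" using permutes_range[OF perm] assms(2) by simp
  then have "w (n + 1 - w k) = w k"
    using gt by (subst before_first_defect) auto
  then show False
    using permutes_eq_iff[OF perm, of "n + 1 - w k" k] gt assms(1) \<open>w k \<le> n\<close> by auto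
qed

lemma first_defect_less: "w (first_defect n w) < n + 1 - first_defect n w"
  using from_first_defect[of "first_defect n w"] first_defect_in first_defect_neq by simp

text \<open>The value \<open>n + 1 - a\<close> occurs neither before the first defect
  \<open>a\<close> nor at it. Its position later yields an ascent and a target for the leap.\<close>

lemma obtain_max_after_first_defect:
  obtains k where "first_defect n w < k" "k \<le> n" "w k = n + 1 - first_defect n w"
proof -
  let ?a = "first_defect n w"
  have "n + 1 - ?a \<in> w ` {1..n}"
    using permutes_image[OF perm] first_defect_in by auto
  then obtain k where k: "1 \<le> k" "k \<le> n" "w k = n + 1 - ?a" by auto
  have "k \<noteq> ?a" using k first_defect_less by auto
  moreover have "\<not> k < ?a" using k before_first_defect[of k] first_defect_in by auto
  ultimately show ?thesis using k by (intro that[of k]) auto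
qed

text \<open>Before the first defect the values fall by one at each position, and the step into the
  first defect is again a descent by \<open>from_first_defect\<close>.\<close>

lemma first_defect_le_ascent:
  assumes "1 \<le> j" "j < n" "w j < w (j + 1)"
  shows "first_defect n w \<le> j"
proof (rule ccontr)
  assume *: "\<not> first_defect n w \<le> j"
  then have j: "w j = n + 1 - j" using assms before_first_defect by simp
  show False
  proof (cases "j + 1 < first_defect n w")
    case True
    then show ?thesis using j assms before_first_defect[of "j + 1"] by simp
  next
    case False
    then have "j + 1 = first_defect n w" using * by simp
    then show ?thesis using j assms from_first_defect[of "j + 1"] by simp
  qed
qed

text \<open>The maximum of the values from the first defect on sits strictly later, so the position
  just before it is an ascent.\<close>

lemma obtain_ascent:
  obtains j where "1 \<le> j" "j < n" "w j < w (j + 1)"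
proof -
  let ?a = "first_defect n w"
  obtain k where k: "?a < k" "k \<le> n" "w k = n + 1 - ?a"
    by (rule obtain_max_after_first_defect)
  have "1 \<le> k - 1" "k - 1 < n" "?a \<le> k - 1" using k first_defect_in by auto
  moreover from this have "w (k - 1) \<le> w k" using k from_first_defect[of "k - 1"] by simp
  moreover have "w (k - 1) \<noteq> w k" using permutes_eq_iff[OF perm] k(1) by simp
  ultimately show ?thesis using k(1) by (intro that[of "k - 1"]) auto
qed

end

lemma first_defect_eqI:
  assumes "1 \<le> a" "a \<le> n" "\<And>k. 1 \<le> k \<Longrightarrow> k < a \<Longrightarrow> w k = n + 1 - k" "w a \<noteq> n + 1 - a"
  shows "first_defect n w = a"
  unfolding first_defect_def
  using assms by (intro Least_equality) (auto simp: not_less[symmetric])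

text \<open>
  The division by \<open>x\<^sub>a\<close> simply discards monomials without \<open>x\<^sub>a\<close>; none occur, by
  \<open>keys_cotransition_poly_lower\<close>.  Arguments outside \<open>S\<^sub>n\<close> get a junk value.
\<close>

function cotransition_poly :: "nat \<Rightarrow> (nat \<Rightarrow> nat) \<Rightarrow> mpoly" where
  "cotransition_poly n w =
     (if w permutes {1..n} \<and> w \<noteq> longest_perm n
      then divide_x_var (first_defect n w)
        (\<Sum>b\<in>climbs n w (first_defect n w). cotransition_poly n (w \<circ> transpose (first_defect n w) b))
      else \<Prod>k=1..n. x_var k ^ (n - k))"
  by auto
termination
proof (relation "measure (\<lambda>(n, w). position_sum n w)", simp, clarify)
  fix n w b
  assume "w permutes {1..n}" "w \<noteq> longest_perm n" "b \<in> climbs n w (first_defect n w)"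
  then show "((n, w \<circ> transpose (first_defect n w) b), n, w) \<in> measure (\<lambda>(n, w). position_sum n w)"
    using first_defect_in(1) climbsD by (simp add: position_sum_swap_less)
qed

declare cotransition_poly.simps [simp del]

lemma cotransition_poly_longest:
  "cotransition_poly n (longest_perm n) = (\<Prod>k=1..n. x_var k ^ (n - k))"
  by (simp add: cotransition_poly.simps)

lemma prod_x_var_power_eq_single:
  "finite A \<Longrightarrow> (\<Prod>k\<in>A. x_var k ^ e k) = Poly_Mapping.single (\<Sum>k\<in>A. Poly_Mapping.single k (e k)) 1"
proof (induction A rule: finite_induct)
  case (insert k A)
  have "x_var k ^ d = Poly_Mapping.single (Poly_Mapping.single k d) 1" for d
    by (induction d) (simp_all add: x_var_def mult_single flip: single_add)
  then show ?case using insert by (simp add: mult_single)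
qed simp

lemma lookup_sum_single:
  assumes "finite A"
  shows "Poly_Mapping.lookup (\<Sum>k\<in>A. Poly_Mapping.single k (e k)) i = (if i \<in> A then e i else (0::nat))"
  using assms by (simp add: lookup_sum lookup_single when_def)

lemma permutes_induct_up [consumes 1, case_names step]:
  assumes "w permutes {1..n}"
    and step: "\<And>w. w permutes {1..n} \<Longrightarrow>
      (\<And>v. v permutes {1..n} \<Longrightarrow> position_sum n v < position_sum n w \<Longrightarrow> P v) \<Longrightarrow> P w"
  shows "P w"
  using assms(1) by (induction w rule: measure_induct_rule[of "position_sum n"]) (blast intro: step)

lemma climb_props:
  assumes "w permutes {1..n}" "w \<noteq> longest_perm n" "b \<in> climbs n w (first_defect n w)"
  shows "w \<circ> transpose (first_defect n w) b permutes {1..n}"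
    "position_sum n (w \<circ> transpose (first_defect n w) b) < position_sum n w"
  using first_defect_in[OF assms(1,2)] climbsD[OF assms(3)] permutes_swap[OF assms(1)]
    position_sum_swap_less[of "first_defect n w" b n w] by auto

lemma keys_cotransition_poly_step:
  assumes "w permutes {1..n}" "w \<noteq> longest_perm n" "m \<in> Poly_Mapping.keys (cotransition_poly n w)"
  obtains b where "b \<in> climbs n w (first_defect n w)"
    "m + Poly_Mapping.single (first_defect n w) 1
      \<in> Poly_Mapping.keys (cotransition_poly n (w \<circ> transpose (first_defect n w) b))"
proof -
  have "m + Poly_Mapping.single (first_defect n w) 1
      \<in> Poly_Mapping.keys (\<Sum>b\<in>climbs n w (first_defect n w).
          cotransition_poly n (w \<circ> transpose (first_defect n w) b))"
    using assms by (simp add: cotransition_poly.simps[of n w] in_keys_iff lookup_divide_x_var)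
  from subsetD[OF keys_sum this] that show ?thesis by (elim UN_E)
qed

text \<open>This makes the division in \<open>cotransition_poly\<close> exact. The agreement before
  \<open>k\<close> forces \<open>k\<close> to be at most the first defect \<open>a\<close>. If
  \<open>k < a\<close>, a climb leaves position \<open>k\<close> alone; if \<open>k = a\<close>, it
  raises the value there by at least one, which pays for the factor \<open>x_a\<close> divided
  out.\<close>

lemma keys_cotransition_poly_lower:
  assumes "w permutes {1..n}" "m \<in> Poly_Mapping.keys (cotransition_poly n w)"
    "1 \<le> k" "k \<le> n" "\<And>i. 1 \<le> i \<Longrightarrow> i < k \<Longrightarrow> w i = n + 1 - i"
  shows "w k \<le> Poly_Mapping.lookup m k + 1"
  using assms
proof (induction w arbitrary: m rule: permutes_induct_up)
  case (step w)
  show ?case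
  proof (cases "w = longest_perm n")
    case True
    then have "m = (\<Sum>k=1..n. Poly_Mapping.single k (n - k))"
      using step.prems(1) by (simp add: cotransition_poly_longest prod_x_var_power_eq_single)
    then show ?thesis
      using True step.prems by (simp add: lookup_sum_single longest_perm_def)
  next
    case False
    let ?a = "first_defect n w"
    note perm = step.hyps
    note a = first_defect_in[OF perm False] first_defect_neq[OF perm False]
    obtain b where b: "b \<in> climbs n w ?a" "m + Poly_Mapping.single ?a 1
        \<in> Poly_Mapping.keys (cotransition_poly n (w \<circ> transpose ?a b))"
      by (rule keys_cotransition_poly_step[OF perm False step.prems(1)])
    have "k \<le> ?a" using step.prems(4)[of ?a] a by linarith
    have "(w \<circ> transpose ?a b) k \<le> Poly_Mapping.lookup (m + Poly_Mapping.single ?a 1) k + 1"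
      using step.IH[OF climb_props[OF perm False b(1)] b(2)] step.prems \<open>k \<le> ?a\<close> climbsD[OF b(1)]
      by (auto simp: transpose_def)
    then show ?thesis
      using \<open>k \<le> ?a\<close> climbsD[OF b(1)]
      by (cases "k = ?a") (auto simp: transpose_def lookup_add lookup_single_not_eq)
  qed
qed

lemma x_var_mult_cotransition_poly:
  assumes "w permutes {1..n}" "w \<noteq> longest_perm n"
  shows "x_var (first_defect n w) * cotransition_poly n w =
    (\<Sum>b\<in>climbs n w (first_defect n w). cotransition_poly n (w \<circ> transpose (first_defect n w) b))"
proof -
  let ?a = "first_defect n w"
  note a = first_defect_in[OF assms]
  have "0 < Poly_Mapping.lookup m ?a"
    if m: "m \<in> Poly_Mapping.keys (\<Sum>b\<in>climbs n w ?a. cotransition_poly n (w \<circ> transpose ?a b))" for m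
  proof -
    obtain b where b: "b \<in> climbs n w ?a"
      "m \<in> Poly_Mapping.keys (cotransition_poly n (w \<circ> transpose ?a b))"
      using subsetD[OF keys_sum m] by (elim UN_E)
    \<comment> \<open>After the climb the value at \<open>?a\<close> is \<open>w b\<close>, which
      exceeds \<open>w ?a\<close> and hence 1, so the exponent is positive.\<close>
    have "(w \<circ> transpose ?a b) ?a \<le> Poly_Mapping.lookup m ?a + 1"
      using a climbsD[OF b(1)] before_first_defect[OF assms]
      by (intro keys_cotransition_poly_lower[OF climb_props(1)[OF assms b(1)] b(2)])
        (auto simp: transpose_def)
    moreover have "1 \<le> w ?a" using permutes_range[OF assms(1)] a by simp
    ultimately show ?thesis using climbsD(3)[OF b(1)] by simp
  qed
  then have "x_var ?a * divide_x_var ?a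
      (\<Sum>b\<in>climbs n w ?a. cotransition_poly n (w \<circ> transpose ?a b)) =
      (\<Sum>b\<in>climbs n w ?a. cotransition_poly n (w \<circ> transpose ?a b))"
    by (rule x_var_mult_divide_x_var)
  then show ?thesis using assms by (simp add: cotransition_poly.simps[of n w])
qed

text \<open>This excludes cancellation: the term contributed by the leap survives in the sum over
  all climbs.\<close>

lemma lookup_cotransition_poly_nonneg:
  assumes "w permutes {1..n}"
  shows "0 \<le> Poly_Mapping.lookup (cotransition_poly n w) m"
  using assms
proof (induction w arbitrary: m rule: permutes_induct_up)
  case (step w)
  show ?case
  proof (cases "w = longest_perm n")
    case True
    then show ?thesis
      by (simp add: cotransition_poly_longest prod_x_var_power_eq_single lookup_single when_def)
  next
    case False
    then show ?thesis
      using step climb_props[OF step.hyps False]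
      by (simp add: cotransition_poly.simps[of n w] lookup_divide_x_var lookup_sum sum_nonneg)
  qed
qed

subsection \<open>Compatibility with divided differences\<close>

text \<open>Division-free form of the recursion for Schubert polynomials at
  \<open>j\<close>.\<close>

definition descends_to :: "nat \<Rightarrow> (nat \<Rightarrow> nat) \<Rightarrow> nat \<Rightarrow> bool" where
  "descends_to n w j \<longleftrightarrow>
     cotransition_poly n w * (x_var j - x_var (j + 1)) =
     cotransition_poly n (w \<circ> transpose j (j + 1)) -
       swap_vars j (cotransition_poly n (w \<circ> transpose j (j + 1)))"

lemma descends_to_symmetric:
  "descends_to n w j \<Longrightarrow> swap_vars j (cotransition_poly n w) = cotransition_poly n w"
  unfolding descends_to_def by (rule symmetric_divided_difference)

lemma comp_transpose_transpose [simp]: "w \<circ> transpose i j \<circ> transpose i j = w"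
  by (simp add: fun_eq_iff)

lemma comp_transpose_conjugate:
  fixes a b j :: nat
  assumes "a < j"
  shows "w \<circ> transpose j (j + 1) \<circ> transpose a b \<circ> transpose j (j + 1) =
    w \<circ> transpose a (transpose j (j + 1) b)"
  using assms by (auto simp: fun_eq_iff transpose_def)

text \<open>If \<open>b\<close> is neither \<open>j\<close> nor \<open>j + 1\<close>, the positions
  between \<open>a\<close> and \<open>b\<close> include both of \<open>j\<close>,
  \<open>j + 1\<close> or neither, so the exchange preserves the climb condition. In the remaining
  cases \<open>u\<close> and \<open>w\<close> differ by one betweenness test, which the descent
  condition at \<open>j\<close> accounts for.\<close>

lemma climbs_transpose_iff:
  assumes perm: "w permutes {1..n}" and j: "1 \<le> a" "a < j" "j < n" "w j < w (j + 1)"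
  defines "u \<equiv> w \<circ> transpose j (j + 1)"
  shows "b \<in> climbs n u a \<and> (u \<circ> transpose a b) (j + 1) < (u \<circ> transpose a b) j \<longleftrightarrow>
    transpose j (j + 1) b \<in> climbs n w a"
proof -
  have u: "u j = w (j + 1)" "u (j + 1) = w j" "\<And>k. k \<noteq> j \<Longrightarrow> k \<noteq> j + 1 \<Longrightarrow> u k = w k"
    by (simp_all add: u_def)
  have ne: "w a \<noteq> w j" "w a \<noteq> w (j + 1)"
    using permutes_eq_iff[OF perm] j by simp_all
  have below: "(\<forall>k. a < k \<and> k < j \<longrightarrow> P (u k)) \<longleftrightarrow> (\<forall>k. a < k \<and> k < j \<longrightarrow> P (w k))" for P
    using u(3) by auto
  have upto: "(\<forall>k. a < k \<and> k < j + 1 \<longrightarrow> P k) \<longleftrightarrow> P j \<and> (\<forall>k. a < k \<and> k < j \<longrightarrow> P k)" for P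
    using j(2) by (auto simp: less_Suc_eq)
  consider "b = j" | "b = j + 1" | "b \<noteq> j" "b \<noteq> j + 1" by blast
  then show ?thesis
  proof cases
    case 1
    have "b \<in> climbs n u a \<longleftrightarrow> w a < w (j + 1) \<and>
        (\<forall>k. a < k \<and> k < j \<longrightarrow> \<not> (w a < w k \<and> w k < w (j + 1)))"
      using 1 j u below[of "\<lambda>y. \<not> (w a < y \<and> y < w (j + 1))"] by (simp add: climbs_def)
    moreover have "transpose j (j + 1) b \<in> climbs n w a \<longleftrightarrow> w a < w (j + 1) \<and>
        \<not> (w a < w j \<and> w j < w (j + 1)) \<and>
        (\<forall>k. a < k \<and> k < j \<longrightarrow> \<not> (w a < w k \<and> w k < w (j + 1)))"
      using 1 j upto[of "\<lambda>k. \<not> (w a < w k \<and> w k < w (j + 1))"] by (simp add: climbs_def)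
    moreover have "(u \<circ> transpose a b) (j + 1) = w j" "(u \<circ> transpose a b) j = w a"
      using 1 j u by (simp_all add: transpose_def)
    ultimately show ?thesis using ne j(4) by auto
  next
    case 2
    have "b \<in> climbs n u a \<longleftrightarrow> w a < w j \<and> \<not> (w a < w (j + 1) \<and> w (j + 1) < w j) \<and>
        (\<forall>k. a < k \<and> k < j \<longrightarrow> \<not> (w a < w k \<and> w k < w j))"
      using 2 j u below[of "\<lambda>y. \<not> (w a < y \<and> y < w j)"]
        upto[of "\<lambda>k. \<not> (w a < u k \<and> u k < w j)"] by (simp add: climbs_def)
    moreover have "transpose j (j + 1) b \<in> climbs n w a \<longleftrightarrow> w a < w j \<and>
        (\<forall>k. a < k \<and> k < j \<longrightarrow> \<not> (w a < w k \<and> w k < w j))"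
      using 2 j by (simp add: climbs_def)
    moreover have "(u \<circ> transpose a b) (j + 1) = w a" "(u \<circ> transpose a b) j = w (j + 1)"
      using 2 j u by (simp_all add: transpose_def)
    ultimately show ?thesis using ne j(4) by auto
  next
    case 3
    have *: "a < transpose j (j + 1) k \<and> transpose j (j + 1) k < b \<longleftrightarrow> a < k \<and> k < b" for k
      using 3 j by (auto simp: transpose_def)
    have "(\<forall>k. a < k \<and> k < b \<longrightarrow> P (u k)) \<longleftrightarrow> (\<forall>k. a < k \<and> k < b \<longrightarrow> P (w k))" for P
      unfolding u_def comp_def by (metis * transpose_involutory)
    from this[of "\<lambda>y. \<not> (w a < y \<and> y < w b)"]
    have "b \<in> climbs n u a \<longleftrightarrow> transpose j (j + 1) b \<in> climbs n w a"
      using 3 j u by (simp add: climbs_def)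
    moreover have "(u \<circ> transpose a b) (j + 1) = w j" "(u \<circ> transpose a b) j = w (j + 1)"
      using 3 j u by (simp_all add: transpose_def)
    ultimately show ?thesis using j(4) by auto
  qed
qed

text \<open>
  The divided difference at \<open>j > a\<close> commutes with \<open>x\<^sub>a\<close>; it maps the co-transition formula of \<open>w s\<^sub>j\<close>
  to that of \<open>w\<close>.
\<close>

lemma descends_to_after_first_defect:
  assumes perm: "w permutes {1..n}" and ne: "w \<noteq> longest_perm n"
    and j: "first_defect n w < j" "j < n" "w j < w (j + 1)"
    and IH: "\<And>v i. v permutes {1..n} \<Longrightarrow> position_sum n v < position_sum n w \<Longrightarrow>
      1 \<le> i \<Longrightarrow> i < n \<Longrightarrow> v i < v (i + 1) \<Longrightarrow> descends_to n v i"
  shows "descends_to n w j"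
proof -
  define a where "a = first_defect n w"
  define u where "u = w \<circ> transpose j (j + 1)"
  let ?T = "cotransition_poly n" and ?s = "transpose j (j + 1)" and ?x = "x_var j - x_var (j + 1)"
  note a = first_defect_in[OF perm ne, folded a_def] first_defect_neq[OF perm ne, folded a_def]
  have aj: "a < j" using j by (simp add: a_def)
  have u_perm: "u permutes {1..n}"
    unfolding u_def using j aj a by (intro permutes_swap[OF perm]) auto
  have u_less: "position_sum n u < position_sum n w"
    unfolding u_def using j aj by (intro position_sum_swap_less) auto
  have u_same: "u k = w k" if "k \<le> a" for k
    using that aj by (simp add: u_def)
  have u_defect: "first_defect n u = a"
    using a before_first_defect[OF perm ne, folded a_def] u_same
    by (intro first_defect_eqI) auto
  have u_ne: "u \<noteq> longest_perm n"
    using a u_same[of a] by (auto simp: longest_perm_def)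
  let ?D = "\<lambda>b. (u \<circ> transpose a b) (j + 1) < (u \<circ> transpose a b) j"
  \<comment> \<open>A climb of \<open>u\<close> with an ascent at \<open>j\<close> has a symmetric
    polynomial by induction and contributes nothing; one with a descent at \<open>j\<close> lies
    over a climb of \<open>w\<close>, to which the induction hypothesis applies.\<close>
  have summand: "?T (u \<circ> transpose a b) - swap_vars j (?T (u \<circ> transpose a b)) =
      (if ?D b then ?T (w \<circ> transpose a (?s b)) * ?x else 0)"
    if b: "b \<in> climbs n u a" for b
  proof -
    define v where "v = u \<circ> transpose a b"
    have v: "v permutes {1..n}" "position_sum n v < position_sum n w"
      using climb_props[OF u_perm u_ne, unfolded u_defect, OF b] u_less
      by (auto simp: v_def intro: less_trans)
    have "v j \<noteq> v (j + 1)" using permutes_eq_iff[OF v(1)] by simp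
    then consider "v j < v (j + 1)" | "v (j + 1) < v j" by linarith
    then show ?thesis
    proof cases
      case 1
      then have "swap_vars j (?T v) = ?T v"
        using IH[OF v] j aj a by (intro descends_to_symmetric) auto
      then show ?thesis using 1 by (simp add: v_def)
    next
      case 2
      have eq: "v \<circ> ?s = w \<circ> transpose a (?s b)"
        unfolding v_def u_def using aj by (rule comp_transpose_conjugate)
      have mem: "?s b \<in> climbs n w a"
        using climbs_transpose_iff[OF perm a(1) aj j(2,3), folded u_def, of b] b 2[unfolded v_def] by blast
      have "descends_to n (v \<circ> ?s) j"
        using climb_props[OF perm ne, folded a_def, OF mem, folded eq] j aj a 2
        by (intro IH) simp_all
      then have "?T v - swap_vars j (?T v) = ?T (w \<circ> transpose a (?s b)) * ?x"
        unfolding descends_to_def comp_transpose_transpose by (simp only: eq)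
      then show ?thesis using 2 unfolding v_def by simp
    qed
  qed
  have "x_var a * (?T u - swap_vars j (?T u)) =
      (\<Sum>b\<in>climbs n u a. ?T (u \<circ> transpose a b) - swap_vars j (?T (u \<circ> transpose a b)))"
  proof -
    have *: "x_var a * ?T u = (\<Sum>b\<in>climbs n u a. ?T (u \<circ> transpose a b))"
      using x_var_mult_cotransition_poly[OF u_perm u_ne] u_defect by simp
    have "swap_vars j (x_var a) = x_var a" using aj by simp
    then have "x_var a * swap_vars j (?T u) = (\<Sum>b\<in>climbs n u a. swap_vars j (?T (u \<circ> transpose a b)))"
      using arg_cong[OF *, of "swap_vars j"] by (simp only: swap_vars_mult swap_vars_sum)
    with * show ?thesis by (simp add: right_diff_distrib sum_subtractf)
  qed
  also have "\<dots> = (\<Sum>b\<in>{b \<in> climbs n u a. ?D b}. ?T (w \<circ> transpose a (?s b)) * ?x)"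
    by (subst sum.inter_filter) (simp_all add: summand cong: sum.cong)
  also have "\<dots> = (\<Sum>b\<in>climbs n w a. ?T (w \<circ> transpose a b) * ?x)"
    using climbs_transpose_iff[OF perm a(1) aj j(2,3), folded u_def]
    by (intro sum.reindex_bij_witness[of _ ?s ?s]) auto
  also have "\<dots> = x_var a * (?T w * ?x)"
    using x_var_mult_cotransition_poly[OF perm ne, folded a_def]
    by (simp add: mult.assoc[symmetric] sum_distrib_right)
  finally show ?thesis by (simp add: descends_to_def u_def)
qed

text \<open>Here \<open>h\<close> arises from \<open>f\<close> by two divided differences. Clearing
  denominators expresses \<open>h\<close> times the product of the three differences of variables
  through \<open>f\<close> and two of its exchanges. The exchange at \<open>i\<close> negates that
  expression, by the braid relation and the symmetry of \<open>f\<close>, and negates the product as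
  well.\<close>

lemma braid_symmetric:
  fixes f g h :: mpoly
  assumes f: "swap_vars (i + 1) f = f"
    and g: "g * (x_var i - x_var (i + 1)) = f - swap_vars i f"
    and h: "h * (x_var (i + 1) - x_var (i + 2)) = g - swap_vars (i + 1) g"
  shows "swap_vars i h = h"
proof -
  let ?s = "swap_vars i" and ?t = "swap_vars (i + 1)"
  let ?X = "x_var i" and ?Y = "x_var (i + 1)" and ?Z = "x_var (i + 2)"
  have s: "?s ?X = ?Y" "?s ?Y = ?X" "?s ?Z = ?Z" and t: "?t ?X = ?X" "?t ?Y = ?Z"
    by (simp_all add: swap_vars_x_var transpose_def)
  have "?t (g * (?X - ?Y)) = ?t (f - ?s f)" using g by simp
  then have tg: "?t g * (?X - ?Z) = f - ?t (?s f)"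
    by (simp only: swap_vars_mult swap_vars_diff t f)
  let ?d = "(?X - ?Y) * (?X - ?Z) * (?Y - ?Z)"
  have "?d * h = (?X - ?Y) * (?X - ?Z) * (h * (?Y - ?Z))" by (simp only: mult_ac)
  also have "\<dots> = (?X - ?Z) * (g * (?X - ?Y)) - (?X - ?Y) * (?t g * (?X - ?Z))"
    unfolding h by (simp add: algebra_simps)
  also have "\<dots> = (?Y - ?Z) * f - (?X - ?Z) * ?s f + (?X - ?Y) * ?t (?s f)"
    unfolding g tg by (simp add: algebra_simps)
  finally have E: "?d * h = (?Y - ?Z) * f - (?X - ?Z) * ?s f + (?X - ?Y) * ?t (?s f)" .
  have braid: "?s (?t (?s f)) = ?t (?s f)"
    using swap_vars_braid[of i f] f by simp
  have "?s (?d * h) = ?s ((?Y - ?Z) * f - (?X - ?Z) * ?s f + (?X - ?Y) * ?t (?s f))"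
    by (simp only: E)
  then have "(?Y - ?X) * (?Y - ?Z) * (?X - ?Z) * ?s h =
      (?X - ?Z) * ?s f - (?Y - ?Z) * f + (?Y - ?X) * ?t (?s f)"
    by (simp only: swap_vars_mult swap_vars_diff swap_vars_add s braid swap_vars_involutory)
  also have "\<dots> = - (?d * h)" unfolding E by (simp add: algebra_simps)
  finally have "?d * ?s h = ?d * h" by (simp add: algebra_simps)
  moreover have "?d \<noteq> 0" by simp
  ultimately show ?thesis by (simp only: mult_cancel_left simp_thms)
qed

text \<open>The exponents of \<open>x_a\<close> and \<open>x_(a+1)\<close> in the staircase monomial
  differ by one, and the extra factor evens them out.\<close>

lemma symmetric_longest_poly:
  assumes "1 \<le> a" "a < n"
  shows "swap_vars a (x_var (a + 1) * cotransition_poly n (longest_perm n)) =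
    x_var (a + 1) * cotransition_poly n (longest_perm n)"
proof -
  let ?C = "{1..n} - {a} - {a + 1}"
  let ?R = "\<Prod>k\<in>?C. x_var k ^ (n - k)"
  have "(\<Prod>k=1..n. x_var k ^ (n - k)) = x_var a ^ (n - a) * (x_var (a + 1) ^ (n - (a + 1)) * ?R)"
    using assms by (subst prod.remove[of _ a], simp, simp, subst prod.remove[of _ "a + 1"], simp_all)
  then have "x_var (a + 1) * cotransition_poly n (longest_perm n) =
      x_var a ^ (n - a) * (x_var (a + 1) ^ Suc (n - (a + 1)) * ?R)"
    by (simp only: cotransition_poly_longest power_Suc mult_ac)
  also have "Suc (n - (a + 1)) = n - a" using assms by simp
  finally have eq: "x_var (a + 1) * cotransition_poly n (longest_perm n) =
      x_var a ^ (n - a) * (x_var (a + 1) ^ (n - a) * ?R)" .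
  have "swap_vars a ?R = ?R"
    by (simp add: swap_vars_prod swap_vars_power)
  then show ?thesis
    unfolding eq by (simp only: swap_vars_mult swap_vars_power swap_vars_x_var_cases mult_ac)
qed

section \<open>The divided difference at the first defect\<close>

context
  fixes n :: nat and w :: "nat \<Rightarrow> nat" and a :: nat
  assumes perm: "w permutes {1..n}" and ne: "w \<noteq> longest_perm n"
    and a_def: "a = first_defect n w" and a_less: "a < n" and asc: "w a < w (a + 1)"
    and IH: "\<And>v i. v permutes {1..n} \<Longrightarrow> position_sum n v < position_sum n w \<Longrightarrow>
      1 \<le> i \<Longrightarrow> i < n \<Longrightarrow> v i < v (i + 1) \<Longrightarrow> descends_to n v i"
begin

private abbreviation "T \<equiv> cotransition_poly n"

lemma one_le_a: "1 \<le> a" and w_a_less: "w a < n + 1 - a"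
  unfolding a_def using first_defect_in[OF perm ne] first_defect_less[OF perm ne] by auto

lemma swap_ascent:
  assumes "1 \<le> j" "j < n" "w j < w (j + 1)"
  shows "w \<circ> transpose j (j + 1) permutes {1..n}"
    "position_sum n (w \<circ> transpose j (j + 1)) < position_sum n w"
  using assms permutes_swap[OF perm] position_sum_swap_less[of j "j + 1" n w] by auto

lemma x_var_mult_split:
  "x_var a * T w = T (w \<circ> transpose a (a + 1)) +
    (\<Sum>b\<in>climbs n w a - {a + 1}. T (w \<circ> transpose a b))"
proof -
  have "a + 1 \<in> climbs n w a"
    using asc a_less by (auto simp: climbs_def)
  then show ?thesis
    using x_var_mult_cotransition_poly[OF perm ne, folded a_def] by (simp add: sum.remove)
qed

text \<open>A climb past \<open>a + 1\<close> must end at a value below \<open>w (a + 1)\<close>,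
  since \<open>w a < w (a + 1)\<close>. So the ascent at \<open>a\<close> survives and induction
  applies.\<close>

lemma other_climb:
  assumes b: "b \<in> climbs n w a - {a + 1}"
  shows "descends_to n (w \<circ> transpose a b) a"
proof -
  have "a + 1 < b" using b climbsD[of b n w a] by auto
  then have "\<not> w (a + 1) < w b" using b asc by (auto simp: climbs_def)
  moreover have "w (a + 1) \<noteq> w b" using \<open>a + 1 < b\<close> permutes_eq_iff[OF perm] by simp
  ultimately have "(w \<circ> transpose a b) a < (w \<circ> transpose a b) (a + 1)"
    using \<open>a + 1 < b\<close> by (simp add: transpose_def)
  then show ?thesis
    using climb_props[OF perm ne, folded a_def] b one_le_a a_less by (intro IH) auto
qed

lemma descends_to_later:
  assumes "a < j" "j < n" "w j < w (j + 1)"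
  shows "descends_to n w j"
  using assms by (intro descends_to_after_first_defect[OF perm ne _ _ _ IH]) (simp_all add: a_def)

text \<open>The polynomial of \<open>w\<close> is the divided difference at \<open>j\<close> of one
  that is symmetric at \<open>a\<close> by induction, and the exchanges at \<open>a\<close> and
  \<open>j\<close> commute.\<close>

lemma symmetric_if_far_ascent:
  assumes j: "a + 1 < j" "j < n" "w j < w (j + 1)"
  shows "swap_vars a (T w) = T w"
proof -
  let ?u = "w \<circ> transpose j (j + 1)"
  have D: "T w * (x_var j - x_var (j + 1)) = T ?u - swap_vars j (T ?u)"
    using descends_to_later[of j] j by (simp add: descends_to_def)
  have "descends_to n ?u a"
    using swap_ascent[of j] j one_le_a a_less asc by (intro IH) auto
  then have "swap_vars a (T ?u) = T ?u" by (rule descends_to_symmetric)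
  moreover have "swap_vars a (x_var j) = x_var j" "swap_vars a (x_var (j + 1)) = x_var (j + 1)"
    using j by (simp_all del: One_nat_def add_Suc_right)
  ultimately have "swap_vars a (T w) * (x_var j - x_var (j + 1)) = T ?u - swap_vars j (T ?u)"
    using arg_cong[OF D, of "swap_vars a"]
    by (simp only: swap_vars_mult swap_vars_diff swap_vars_commute[OF j(1)])
  then have "swap_vars a (T w) * (x_var j - x_var (j + 1)) = T w * (x_var j - x_var (j + 1))"
    using D by simp
  then show ?thesis by simp
qed

text \<open>With \<open>w a < w (a + 1) < w (a + 2)\<close>, two exchanges lead to a permutation
  \<open>?v\<close> that has an ascent at \<open>a + 1\<close>, so its polynomial is symmetric there
  and the braid relation transfers the symmetry to \<open>w\<close>.\<close>

lemma symmetric_if_next_ascent: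
  assumes j: "a + 1 < n" "w (a + 1) < w (a + 2)"
  shows "swap_vars a (T w) = T w"
proof (rule braid_symmetric)
  let ?u = "w \<circ> transpose (a + 1) (a + 2)"
  let ?v = "?u \<circ> transpose a (a + 1)"
  have u: "?u permutes {1..n}" "position_sum n ?u < position_sum n w"
    using swap_ascent[of "a + 1"] j by simp_all
  have u_asc: "?u a < ?u (a + 1)"
    using asc j by (simp add: transpose_def)
  have v: "?v permutes {1..n}" "position_sum n ?v < position_sum n w"
    using permutes_swap[OF u(1), of a "a + 1"] one_le_a a_less
      position_sum_swap_less[of a "a + 1" n ?u] u_asc u(2) by auto
  have v_asc: "?v (a + 1) < ?v (a + 1 + 1)"
    using asc j by (simp add: transpose_def)
  show "T w * (x_var (a + 1) - x_var (a + 2)) = T ?u - swap_vars (a + 1) (T ?u)"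
    using descends_to_later[of "a + 1"] j by (simp add: descends_to_def)
  show "T ?u * (x_var a - x_var (a + 1)) = T ?v - swap_vars a (T ?v)"
    using IH[OF u one_le_a a_less u_asc] unfolding descends_to_def .
  show "swap_vars (a + 1) (T ?v) = T ?v"
    using j by (intro descends_to_symmetric IH[OF v _ _ v_asc]) simp_all
qed

text \<open>
  Here \<open>w(a + 1) = n + 1 - a\<close>, so the first defect of \<open>w s\<^sub>a\<close> is \<open>a + 1\<close>, and applying the co-transition
  formula to \<open>w\<close> and then to \<open>w s\<^sub>a\<close> writes \<open>x\<^sub>a x\<^sub>a\<^sub>+\<^sub>1\<close> times the polynomial of \<open>w\<close> as a sum of symmetric terms.
\<close>

lemma symmetric_if_no_later_ascent:
  assumes no: "\<And>j. a < j \<Longrightarrow> j < n \<Longrightarrow> \<not> w j < w (j + 1)"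
  shows "swap_vars a (T w) = T w"
proof -
  let ?u = "w \<circ> transpose a (a + 1)"
  let ?B = "climbs n w a - {a + 1}"
  \<comment> \<open>The maximal remaining value lies after \<open>a\<close>; placed beyond
    \<open>a + 1\<close> it would create a later ascent.\<close>
  have max: "w (a + 1) = n + 1 - a"
  proof -
    obtain k where k: "a < k" "k \<le> n" "w k = n + 1 - a"
      unfolding a_def by (rule obtain_max_after_first_defect[OF perm ne])
    have "k = a + 1"
    proof (rule ccontr)
      assume "k \<noteq> a + 1"
      then have "a < k - 1" "k - 1 < n" "k - 1 + 1 = k" using k by auto
      moreover have "w (k - 1) \<le> w k"
        using from_first_defect[OF perm ne, folded a_def, of "k - 1"] k by simp
      moreover have "w (k - 1) \<noteq> w k" using permutes_eq_iff[OF perm] k(1) by simp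
      ultimately show False using no[of "k - 1"] by simp
    qed
    then show ?thesis using k by simp
  qed
  have B: "a + 1 < b \<and> b \<le> n \<and> w a < w b \<and> w b < n + 1 - a" if "b \<in> ?B" for b
  proof -
    have b: "a < b" "b \<le> n" "w a < w b" "b \<noteq> a + 1" using that climbsD[of b n w a] by auto
    then have "w b \<le> n + 1 - a" "w b \<noteq> w (a + 1)"
      using from_first_defect[OF perm ne, folded a_def, of b] permutes_eq_iff[OF perm] by auto
    then show ?thesis using b max by auto
  qed
  have "swap_vars a (x_var (a + 1) * (x_var a * T w)) = x_var (a + 1) * (x_var a * T w)"
  proof (cases "?u = longest_perm n")
    case True
    \<comment> \<open>Then \<open>w a = n - a\<close>, and no value is left strictly between
      \<open>w a\<close> and \<open>n + 1 - a\<close> for another climb.\<close>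
    have "w a = ?u (a + 1)" by simp
    also have "\<dots> = n - a" using True a_less by (simp add: longest_perm_def)
    finally have "?B = {}" using B by fastforce
    then have "x_var a * T w = T (longest_perm n)"
      using x_var_mult_split True by (simp only: sum.empty add_0_right)
    then show ?thesis using symmetric_longest_poly[OF one_le_a a_less] by simp
  next
    case False
    have u_perm: "?u permutes {1..n}" using swap_ascent[of a] one_le_a a_less asc by simp
    have u_defect: "first_defect n ?u = a + 1"
    proof -
      let ?d = "first_defect n ?u"
      have "?u k = n + 1 - k" if "1 \<le> k" "k \<le> a" for k
        using that max before_first_defect[OF perm ne, folded a_def, of k] by (cases "k = a") auto
      then have "a + 1 \<le> ?d"
        using first_defect_in[OF u_perm False] first_defect_neq[OF u_perm False]
        by (metis Suc_eq_plus1 not_less_eq_eq)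
      \<comment> \<open>Otherwise \<open>?u\<close> would have an ascent beyond
        \<open>a + 1\<close>, where it agrees with \<open>w\<close>.\<close>
      moreover have "\<not> a + 1 < ?d"
      proof
        assume "a + 1 < ?d"
        obtain j where j: "1 \<le> j" "j < n" "?u j < ?u (j + 1)"
          by (rule obtain_ascent[OF u_perm False])
        have "a + 1 < j"
          by (rule less_le_trans[OF \<open>a + 1 < ?d\<close> first_defect_le_ascent[OF u_perm False j]])
        then show False using no[of j] j by simp
      qed
      ultimately show ?thesis by simp
    qed
    \<comment> \<open>The only additional test for \<open>w\<close> concerns position
      \<open>a + 1\<close>, whose value is too large to lie between \<open>w a\<close> and
      \<open>w b\<close>.\<close>
    have "climbs n ?u (a + 1) = ?B"
    proof (intro set_eqI iffI)
      fix b assume b: "b \<in> climbs n ?u (a + 1)"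
      then have "a + 1 < b" "b \<le> n" by (auto simp: climbs_def)
      moreover from this have "w b \<le> w (a + 1)"
        using max from_first_defect[OF perm ne, folded a_def, of b] by simp
      moreover have "?u k = w k" if "a + 1 < k" for k using that by simp
      ultimately show "b \<in> ?B"
        using b by (auto simp: climbs_def not_less_eq less_Suc_eq dest: Suc_lessI)
    next
      fix b assume b: "b \<in> ?B"
      then show "b \<in> climbs n ?u (a + 1)"
        using B[OF b] by (auto simp: climbs_def)
    qed
    then have "x_var (a + 1) * T ?u = (\<Sum>b\<in>?B. T (?u \<circ> transpose (a + 1) b))"
      using x_var_mult_cotransition_poly[OF u_perm False] u_defect by simp
    also have "\<dots> = (\<Sum>b\<in>?B. T (w \<circ> transpose a b \<circ> transpose a (a + 1)))"
    proof (intro sum.cong refl arg_cong[of _ _ T])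
      fix b assume "b \<in> ?B"
      then show "?u \<circ> transpose (a + 1) b = w \<circ> transpose a b \<circ> transpose a (a + 1)"
        using B[of b] by (auto simp: fun_eq_iff transpose_def)
    qed
    finally have eq: "x_var (a + 1) * (x_var a * T w) =
        (\<Sum>b\<in>?B. T (w \<circ> transpose a b \<circ> transpose a (a + 1)) + x_var (a + 1) * T (w \<circ> transpose a b))"
      by (simp only: x_var_mult_split distrib_left sum.distrib sum_distrib_left)
    \<comment> \<open>The exchange lowers the first term by
      \<open>T v * (x_var a - x_var (a + 1))\<close> and raises the second by the same
      amount.\<close>
    have "swap_vars a (T (v \<circ> transpose a (a + 1)) + x_var (a + 1) * T v) =
        T (v \<circ> transpose a (a + 1)) + x_var (a + 1) * T v"
      if "descends_to n v a" for v
    proof -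
      have "swap_vars a (T (v \<circ> transpose a (a + 1))) =
          T (v \<circ> transpose a (a + 1)) - T v * (x_var a - x_var (a + 1))"
        using that unfolding descends_to_def by simp
      moreover have "swap_vars a (x_var (a + 1) * T v) = x_var a * T v"
        using descends_to_symmetric[OF that]
        by (simp only: swap_vars_mult swap_vars_x_var_cases)
      ultimately show ?thesis
        by (simp only: swap_vars_add) (simp add: algebra_simps)
    qed
    then show ?thesis
      unfolding eq swap_vars_sum by (intro sum.cong refl) (use other_climb in blast)
  qed
  then have "x_var a * (x_var (a + 1) * swap_vars a (T w)) = x_var (a + 1) * (x_var a * T w)"
    by (simp only: swap_vars_mult swap_vars_x_var_cases)
  then have "(x_var a * x_var (a + 1)) * swap_vars a (T w) = (x_var a * x_var (a + 1)) * T w"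
    by (simp only: mult_ac)
  then show ?thesis by simp
qed

text \<open>
  Every climb from \<open>a\<close> other than the one to \<open>a + 1\<close> keeps the ascent at \<open>a\<close> and hence is symmetric, so the
  co-transition formula gives the claim once the polynomial of \<open>w\<close> itself is known to be symmetric.
\<close>

lemma descends_to_at_first_defect: "descends_to n w a"
proof -
  let ?u = "w \<circ> transpose a (a + 1)"
  let ?R = "\<Sum>b\<in>climbs n w a - {a + 1}. T (w \<circ> transpose a b)"
  have sym: "swap_vars a (T w) = T w"
  proof (cases "\<exists>j. a < j \<and> j < n \<and> w j < w (j + 1)")
    case True
    then obtain j where j: "a < j" "j < n" "w j < w (j + 1)" by blast
    show ?thesis
    proof (cases "j = a + 1")
      case True
      then show ?thesis using j by (intro symmetric_if_next_ascent) auto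
    next
      case False
      then show ?thesis using j by (intro symmetric_if_far_ascent[of j]) auto
    qed
  next
    case False
    then show ?thesis by (intro symmetric_if_no_later_ascent) auto
  qed
  have "swap_vars a ?R = ?R"
    unfolding swap_vars_sum using other_climb by (intro sum.cong refl descends_to_symmetric)
  \<comment> \<open>The co-transition formula and its exchanged form share \<open>?R\<close>; their
    difference is the claim.\<close>
  then have "x_var (a + 1) * T w = swap_vars a (T ?u) + ?R"
    using arg_cong[OF x_var_mult_split, of "swap_vars a"]
    by (simp only: swap_vars_mult swap_vars_add swap_vars_x_var_cases sym)
  then show ?thesis
    using x_var_mult_split unfolding descends_to_def by (simp add: algebra_simps)
qed

end

theorem descends_to_ascent:
  assumes "w permutes {1..n}" "1 \<le> j" "j < n" "w j < w (j + 1)"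
  shows "descends_to n w j"
  using assms
proof (induction w arbitrary: j rule: permutes_induct_up)
  case (step w)
  have ne: "w \<noteq> longest_perm n"
    using step.prems by (auto simp: longest_perm_def)
  have "first_defect n w \<le> j"
    using first_defect_le_ascent[OF step.hyps ne] step.prems by simp
  then consider "first_defect n w < j" | "first_defect n w = j" by linarith
  then show ?case
  proof cases
    case 1
    then show ?thesis
      using step by (intro descends_to_after_first_defect[OF step.hyps ne]) auto
  next
    case 2
    show ?thesis
      by (rule descends_to_at_first_defect[OF step.hyps ne 2[symmetric] step.prems(2,3) step.IH])
  qed
qed

subsection \<open>Schubert polynomials and the leaping chain\<close>

lemma schubert_family_cotransition_poly: "schubert_family n (cotransition_poly n)"
  unfolding schubert_family_def
proof (intro conjI allI impI)
  fix w j
  assume "w permutes {1..n} \<and> 1 \<le> j \<and> j < n \<and> w j < w (j + 1)"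
  then have "descends_to n w j" by (intro descends_to_ascent) auto
  then show "cotransition_poly n w =
      divided_difference j (cotransition_poly n (w \<circ> transpose j (j + 1)))"
    unfolding descends_to_def by (rule divided_difference_eqI[symmetric])
qed (fact cotransition_poly_longest)

text \<open>Every permutation except the longest has an ascent, so each value is forced by one with
  smaller \<open>position_sum\<close>.\<close>

lemma schubert_family_unique:
  assumes "schubert_family n S" "schubert_family n S'" "w permutes {1..n}"
  shows "S w = S' w"
  using assms(3)
proof (induction w rule: permutes_induct_up)
  case (step w)
  show ?case
  proof (cases "w = longest_perm n")
    case True
    then show ?thesis using assms by (simp add: schubert_family_def)
  next
    case False
    obtain j where j: "1 \<le> j" "j < n" "w j < w (j + 1)"
      by (rule obtain_ascent[OF step.hyps False])
    let ?u = "w \<circ> transpose j (j + 1)"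
    have "S ?u = S' ?u"
      using j step.hyps by (intro step.IH permutes_swap position_sum_swap_less) auto
    then show ?thesis
      using assms(1,2) step.hyps j by (simp add: schubert_family_def)
  qed
qed

lemma schubert_eq_cotransition_poly:
  assumes "w permutes {1..n}"
  shows "schubert n w = cotransition_poly n w"
proof (rule schubert_family_unique[OF _ schubert_family_cotransition_poly assms])
  show "schubert_family n (schubert n)"
    unfolding schubert_def by (rule someI[of "schubert_family n", OF schubert_family_cotransition_poly])
qed

text \<open>
  If \<open>w < w t\<^sub>i\<^sub>j \<le> w t\<^sub>a\<^sub>b\<close>, comparing rank functions confines the box of \<open>(i, j)\<close> to that of \<open>(a, b)\<close>,
  so covers are recognised without the length function.
\<close>

definition rank_count :: "(nat \<Rightarrow> nat) \<Rightarrow> nat \<Rightarrow> nat \<Rightarrow> nat" where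
  "rank_count w x y = card {k \<in> {1..x}. y \<le> w k}"

text \<open>Only prefixes containing \<open>i\<close> but not \<open>j\<close> change: they trade
  the value \<open>w i\<close> for \<open>w j\<close>.\<close>

lemma rank_count_swap:
  assumes "1 \<le> i" "i < j" "w i < w j"
  shows "rank_count (w \<circ> transpose i j) x y =
    rank_count w x y + (if i \<le> x \<and> x < j \<and> w i < y \<and> y \<le> w j then 1 else 0)"
proof -
  let ?A = "{k \<in> {1..x}. y \<le> w k}" and ?B = "{k \<in> {1..x}. y \<le> (w \<circ> transpose i j) k}"
  consider "x < i" | "j \<le> x" | "i \<le> x" "x < j" by linarith
  then show ?thesis
  proof cases
    case 1
    then have "?B = ?A" using assms by (auto simp: transpose_def)
    then show ?thesis using 1 by (simp add: rank_count_def)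
  next
    case 2
    have "?B = transpose i j ` ?A"
    proof (intro set_eqI iffI)
      fix k assume "k \<in> ?B"
      then have "transpose i j k \<in> ?A" using 2 assms by (auto simp: transpose_def)
      then show "k \<in> transpose i j ` ?A" by (metis imageI transpose_involutory)
    qed (use 2 assms in \<open>auto simp: transpose_def\<close>)
    then have "card ?B = card ?A" by (simp add: card_image)
    then show ?thesis using 2 by (simp add: rank_count_def)
  next
    case 3
    have "?B = (if w i < y \<and> y \<le> w j then insert i ?A else ?A)"
      using 3 assms by (auto simp: transpose_def split: if_splits)
    moreover have "w i < y \<Longrightarrow> i \<notin> ?A" by simp
    ultimately show ?thesis using 3 by (simp add: rank_count_def)
  qed
qed

lemma rank_count_mono:
  assumes "(bruhat_step n)\<^sup>*\<^sup>* u v"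
  shows "rank_count u x y \<le> rank_count v x y"
  using assms
proof (induction rule: rtranclp_induct)
  case (step v z)
  from step.hyps(2) obtain i j where "1 \<le> i" "i < j" "v i < v j" "z = v \<circ> transpose i j"
    by (auto simp: bruhat_step_def)
  then have "rank_count v x y \<le> rank_count z x y" by (simp only: rank_count_swap le_add1)
  then show ?case using step.IH by simp
qed simp

lemma position_sum_bruhat_less:
  assumes "bruhat_less n u v"
  shows "position_sum n v < position_sum n u"
proof -
  have step: "position_sum n z < position_sum n y" if "bruhat_step n y z" for y z
    using that position_sum_swap_less by (auto simp: bruhat_step_def)
  show ?thesis
    using assms unfolding bruhat_less_def
    by (induction rule: tranclp_induct) (auto dest: step)
qed

text \<open>The first step towards an intermediate element exchanges some \<open>i\<close> and
  \<open>j\<close>. Its box lies inside that of \<open>(a, b)\<close>, and since a climb leaves no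
  point inside, the two boxes coincide. The chain then closes to a cycle, against strict decrease of
  \<open>position_sum\<close>.\<close>

lemma bruhat_covers_climb:
  assumes perm: "w permutes {1..n}" and a: "1 \<le> a" and b: "b \<in> climbs n w a"
  shows "bruhat_covers n w (w \<circ> transpose a b)"
  unfolding bruhat_covers_def
proof (intro conjI notI)
  note ab = climbsD[OF b]
  show "bruhat_less n w (w \<circ> transpose a b)"
    unfolding bruhat_less_def using a ab by (intro tranclp.r_into_trancl) (auto simp: bruhat_step_def)
  assume "\<exists>z. bruhat_less n w z \<and> bruhat_less n z (w \<circ> transpose a b)"
  then obtain z where z: "bruhat_less n w z" "bruhat_less n z (w \<circ> transpose a b)" by blast
  obtain w' where w': "bruhat_step n w w'" "(bruhat_step n)\<^sup>*\<^sup>* w' z"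
    using z(1) unfolding bruhat_less_def by (metis tranclpD)
  obtain i j where ij: "1 \<le> i" "i < j" "j \<le> n" "w i < w j" "w' = w \<circ> transpose i j"
    using w'(1) by (auto simp: bruhat_step_def)
  have "(bruhat_step n)\<^sup>*\<^sup>* w' (w \<circ> transpose a b)"
    using w'(2) z(2) unfolding bruhat_less_def by (meson rtranclp_trans tranclp_into_rtranclp)
  then have le: "rank_count (w \<circ> transpose i j) x y \<le> rank_count (w \<circ> transpose a b) x y" for x y
    unfolding ij(5) by (rule rank_count_mono)
  have box: "a \<le> x \<and> x < b \<and> w a < y \<and> y \<le> w b"
    if "i \<le> x" "x < j" "w i < y" "y \<le> w j" for x y
    using le[of x y] that ij a ab by (simp add: rank_count_swap split: if_splits)
  have "a \<le> i" "w a \<le> w i" using box[of i "w i + 1"] ij by auto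
  moreover have "j \<le> b" "w j \<le> w b" using box[of "j - 1" "w j"] ij(1,2,4) by linarith+
  moreover have "\<not> (a < k \<and> k < b \<and> w a < w k \<and> w k < w b)" for k
    using b by (auto simp: climbs_def)
  moreover have "w i = w a \<longleftrightarrow> i = a" "w j = w b \<longleftrightarrow> j = b"
    using permutes_eq_iff[OF perm] by auto
  ultimately have "i = a" "j = b"
    using ij(2,4) by (metis le_neq_implies_less less_le_trans le_less_trans)+
  then have "bruhat_less n w' w' \<or> bruhat_less n z z"
    using w'(2) z(2) ij(5) unfolding bruhat_less_def by (metis rtranclp_tranclp_tranclp)
  then show False using position_sum_bruhat_less by blast
qed

text \<open>The leap goes to the first later position with a larger value: that is a climb and hence
  a cover, while exchanging \<open>a\<close> with any position before it goes down in the Bruhat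
  order.\<close>

lemma leap_props:
  assumes perm: "w permutes {1..n}" and ne: "w \<noteq> longest_perm n"
  obtains b where "leap n w = (first_defect n w, b)" "b \<in> climbs n w (first_defect n w)"
    "\<forall>k. first_defect n w < k \<and> k < b \<longrightarrow> w k < w (first_defect n w)"
proof -
  let ?a = "first_defect n w"
  let ?P = "\<lambda>k. ?a < k \<and> k \<le> n \<and> w ?a < w k"
  define b where "b = (LEAST k. ?P k)"
  note a = first_defect_in[OF perm ne] first_defect_less[OF perm ne]
  obtain k where "?a < k" "k \<le> n" "w k = n + 1 - ?a"
    by (rule obtain_max_after_first_defect[OF perm ne])
  then have "?P k" using a by simp
  then have b: "?P b" unfolding b_def by (rule LeastI)
  have before: "w k < w ?a" if "?a < k" "k < b" for k
  proof -
    have "\<not> ?P k" using not_less_Least[of k ?P] that by (simp add: b_def)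
    moreover have "w k \<noteq> w ?a" using permutes_eq_iff[OF perm] that by simp
    ultimately show ?thesis using that b by auto
  qed
  have climb: "b \<in> climbs n w ?a" using b before by (fastforce simp: climbs_def)
  have "(LEAST k. k \<in> {1..n} \<and> ?a < k \<and> bruhat_covers n w (w \<circ> transpose ?a k)) = b"
  proof (rule Least_equality)
    show "b \<in> {1..n} \<and> ?a < b \<and> bruhat_covers n w (w \<circ> transpose ?a b)"
      using b a bruhat_covers_climb[OF perm _ climb] by auto
  next
    fix k assume k: "k \<in> {1..n} \<and> ?a < k \<and> bruhat_covers n w (w \<circ> transpose ?a k)"
    let ?v = "w \<circ> transpose ?a k"
    show "b \<le> k"
    proof (rule ccontr)
      assume "\<not> b \<le> k"
      then have "?v ?a < ?v k" using before k by simp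
      then have "position_sum n (?v \<circ> transpose ?a k) < position_sum n ?v"
        using a k by (intro position_sum_swap_less) auto
      moreover have "position_sum n ?v < position_sum n w"
        using k position_sum_bruhat_less by (simp add: bruhat_covers_def)
      ultimately show False by simp
    qed
  qed
  then have "leap n w = (?a, b)"
    unfolding leap_def Let_def first_defect_def[symmetric] by (simp only:)
  then show ?thesis using that climb before by blast
qed

lemma is_leaping_chain_unique:
  "is_leaping_chain n w C \<Longrightarrow> is_leaping_chain n w C' \<Longrightarrow> C = C'"
proof (induction arbitrary: C' rule: is_leaping_chain.induct)
  case longest
  then show ?case by (auto elim: is_leaping_chain.cases)
next
  case (leap w a b C)
  from leap.prems leap.hyps(1,2) obtain C'' where "C' = (a, b) # C''"
    "is_leaping_chain n (w \<circ> transpose a b) C''"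
    by (auto elim: is_leaping_chain.cases)
  then show ?case using leap.IH by blast
qed

lemma leaping_chain_eqI: "is_leaping_chain n w C \<Longrightarrow> leaping_chain n w = C"
  unfolding leaping_chain_def by (blast intro: is_leaping_chain_unique)

subsection \<open>Leading exponents and dominance\<close>

definition larger_before :: "(nat \<Rightarrow> nat) \<Rightarrow> nat \<Rightarrow> nat" where
  "larger_before w j = card {i \<in> {1..<j}. w j < w i}"

text \<open>Row \<open>k\<close> of the partition conjugate to the counts
  \<open>larger_before w\<close>.\<close>

definition leading_exponent :: "nat \<Rightarrow> (nat \<Rightarrow> nat) \<Rightarrow> nat \<Rightarrow> nat" where
  "leading_exponent n w k = card {j \<in> {1..n}. k \<le> larger_before w j}"

lemma leading_exponent_longest:
  assumes "1 \<le> k" "k \<le> n"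
  shows "leading_exponent n (longest_perm n) k = n - k"
proof -
  have "larger_before (longest_perm n) j = j - 1" if "j \<in> {1..n}" for j
  proof -
    have "{i \<in> {1..<j}. longest_perm n j < longest_perm n i} = {1..<j}"
      using that by (auto simp: longest_perm_def)
    then show ?thesis by (simp add: larger_before_def)
  qed
  then have "{j \<in> {1..n}. k \<le> larger_before (longest_perm n) j} = {k + 1..n}"
    using assms by auto
  then show ?thesis by (simp add: leading_exponent_def)
qed

context
  fixes n :: nat and w :: "nat \<Rightarrow> nat" and a b :: nat
  assumes perm: "w permutes {1..n}" and ne: "w \<noteq> longest_perm n"
    and a_def: "a = first_defect n w" and b: "b \<in> climbs n w a"
begin

text \<open>Positions before \<open>a\<close> carry larger values than all from \<open>a\<close> on,
  no value between positions \<open>a\<close> and \<open>b\<close> separates \<open>w a\<close> from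
  \<open>w b\<close>, and positions after \<open>b\<close> see the same values in another order.
  Only \<open>b\<close> gains a larger predecessor, namely \<open>a\<close>.\<close>

lemma larger_before_climb:
  assumes "1 \<le> j" "j \<le> n"
  shows "larger_before (w \<circ> transpose a b) j =
    (if j = b then Suc (larger_before w j) else larger_before w j)"
proof -
  let ?v = "w \<circ> transpose a b"
  note ab = climbsD[OF b]
  have a: "1 \<le> a" using first_defect_in[OF perm ne] a_def by simp
  have inj: "w i = w k \<longleftrightarrow> i = k" for i k using permutes_eq_iff[OF perm] by simp
  have before: "w k < w i" if "1 \<le> i" "i < a" "a \<le> k" "k \<le> n" for i k
    using before_first_defect[OF perm ne, folded a_def, OF that(1,2)]
      from_first_defect[OF perm ne, folded a_def, OF that(3,4)] that by simp
  have gap: "w b < w k \<longleftrightarrow> w a < w k" if "a < k" "k < b" for k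
  proof -
    have "\<not> (w a < w k \<and> w k < w b)" using b that by (auto simp: climbs_def)
    then show ?thesis using inj[of k b] that ab by auto
  qed
  consider "j < a" | "j = a" | "a < j" "j < b" | "j = b" | "b < j" using ab by linarith
  then show ?thesis
  proof cases
    case 1
    then have "{i \<in> {1..<j}. ?v j < ?v i} = {i \<in> {1..<j}. w j < w i}"
      using ab by (auto simp: transpose_def)
    then show ?thesis using 1 ab by (simp add: larger_before_def)
  next
    case 2
    have "{i \<in> {1..<j}. ?v j < ?v i} = {i \<in> {1..<j}. w j < w i}"
      using 2 ab before by (auto simp: transpose_def)
    then show ?thesis using 2 ab by (simp add: larger_before_def)
  next
    case 3
    have "w j < w b \<longleftrightarrow> w j < w a"
      using gap[OF 3] inj[of j a] inj[of j b] 3 by auto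
    then have "{i \<in> {1..<j}. ?v j < ?v i} = {i \<in> {1..<j}. w j < w i}"
      using 3 by (auto simp: transpose_def split: if_splits)
    then show ?thesis using 3 by (simp add: larger_before_def)
  next
    case 4
    have "{i \<in> {1..<b}. ?v b < ?v i} = insert a {i \<in> {1..<b}. w b < w i}"
    proof (intro set_eqI)
      fix i
      show "i \<in> {i \<in> {1..<b}. ?v b < ?v i} \<longleftrightarrow> i \<in> insert a {i \<in> {1..<b}. w b < w i}"
        using ab a before[of i a] before[of i b] gap[of i]
        by (cases i a rule: linorder_cases) (auto simp: transpose_def)
    qed
    then show ?thesis using 4 ab by (simp add: larger_before_def)
  next
    case 5
    have "{i \<in> {1..<j}. ?v j < ?v i} = transpose a b ` {i \<in> {1..<j}. w j < w i}"
    proof (intro set_eqI iffI)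
      fix i assume "i \<in> {i \<in> {1..<j}. ?v j < ?v i}"
      then have "transpose a b i \<in> {i \<in> {1..<j}. w j < w i}"
        using 5 a ab by (auto simp: transpose_def split: if_splits)
      then show "i \<in> transpose a b ` {i \<in> {1..<j}. w j < w i}"
        by (metis imageI transpose_involutory)
    qed (use 5 a ab in \<open>auto simp: transpose_def split: if_splits\<close>)
    then show ?thesis using 5 by (simp add: larger_before_def card_image)
  qed
qed

text \<open>Raising one count by one adds a single box to the conjugate partition, in the row of the
  new count.\<close>

lemma leading_exponent_climb:
  "leading_exponent n (w \<circ> transpose a b) k =
    leading_exponent n w k + (if k = larger_before w b + 1 then 1 else 0)"
proof -
  let ?A = "{j \<in> {1..n}. k \<le> larger_before w j}"
  have "1 \<le> b" "b \<le> n" using climbsD[OF b] by auto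
  then have "{j \<in> {1..n}. k \<le> larger_before (w \<circ> transpose a b) j} =
      (if k = larger_before w b + 1 then insert b ?A else ?A)"
    by (auto simp: larger_before_climb simp del: comp_apply split: if_splits)
  moreover have "k = larger_before w b + 1 \<Longrightarrow> b \<notin> ?A" by simp
  ultimately show ?thesis by (simp add: leading_exponent_def)
qed

text \<open>All \<open>a - 1\<close> positions before the first defect hold values larger than
  \<open>w b\<close>.\<close>

lemma larger_before_climb_ge: "a \<le> larger_before w b + 1"
proof -
  have "{1..<a} \<subseteq> {i \<in> {1..<b}. w b < w i}"
    using climbsD[OF b] before_first_defect[OF perm ne, folded a_def]
      from_first_defect[OF perm ne, folded a_def, of b] by auto
  from card_mono[OF _ this] show ?thesis by (simp add: larger_before_def)
qed

lemma larger_before_leap: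
  assumes "\<forall>k. a < k \<and> k < b \<longrightarrow> w k < w a"
  shows "larger_before w b + 1 = a"
proof -
  have "{i \<in> {1..<b}. w b < w i} \<subseteq> {1..<a}"
  proof
    fix i assume i: "i \<in> {i \<in> {1..<b}. w b < w i}"
    then have "\<not> a < i" "i \<noteq> a" using assms climbsD[OF b] by (auto dest: spec[of _ i])
    then show "i \<in> {1..<a}" using i by simp
  qed
  from card_mono[OF _ this] have "larger_before w b \<le> a - 1" by (simp add: larger_before_def)
  moreover have "1 \<le> a" using first_defect_in[OF perm ne] a_def by simp
  ultimately show ?thesis using larger_before_climb_ge by simp
qed

end

text \<open>Going from a climb back to \<open>w\<close>, the monomial loses one factor
  \<open>x_a\<close>, which lowers its partial sums from \<open>a\<close> on. The bound loses a box
  in row \<open>larger_before w b + 1\<close>, which is at least \<open>a\<close>, so its partial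
  sums drop no earlier and dominance persists.\<close>

lemma keys_cotransition_poly_dominated:
  assumes "w permutes {1..n}" "m \<in> Poly_Mapping.keys (cotransition_poly n w)"
  shows "m \<in> monomials n \<and>
    (\<forall>i\<le>n. (\<Sum>k=1..i. Poly_Mapping.lookup m k) \<le> (\<Sum>k=1..i. leading_exponent n w k))"
  using assms
proof (induction w arbitrary: m rule: permutes_induct_up)
  case (step w)
  show ?case
  proof (cases "w = longest_perm n")
    case True
    then have m: "m = (\<Sum>k=1..n. Poly_Mapping.single k (n - k))"
      using step.prems by (simp add: cotransition_poly_longest prod_x_var_power_eq_single)
    have "k \<in> {1..n}" if "k \<in> Poly_Mapping.keys m" for k
      using that by (simp add: m in_keys_iff lookup_sum_single split: if_splits)
    moreover have "(\<Sum>k=1..i. Poly_Mapping.lookup m k) = (\<Sum>k=1..i. leading_exponent n w k)"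
      if "i \<le> n" for i
      using that True by (intro sum.cong) (simp_all add: m lookup_sum_single leading_exponent_longest)
    ultimately show ?thesis by (auto simp: monomials_def)
  next
    case False
    let ?a = "first_defect n w"
    note perm = step.hyps
    note a = first_defect_in[OF perm False]
    obtain b where b: "b \<in> climbs n w ?a" and "m + Poly_Mapping.single ?a 1
        \<in> Poly_Mapping.keys (cotransition_poly n (w \<circ> transpose ?a b))"
      by (rule keys_cotransition_poly_step[OF perm False step.prems])
    then have IH: "m + Poly_Mapping.single ?a 1 \<in> monomials n"
      "\<And>i. i \<le> n \<Longrightarrow> (\<Sum>k=1..i. Poly_Mapping.lookup (m + Poly_Mapping.single ?a 1) k) \<le>
        (\<Sum>k=1..i. leading_exponent n (w \<circ> transpose ?a b) k)"
      using step.IH[OF climb_props[OF perm False b]] by blast+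
    have "Poly_Mapping.keys m \<subseteq> Poly_Mapping.keys (m + Poly_Mapping.single ?a 1)"
      by (auto simp: in_keys_iff lookup_add)
    then have "m \<in> monomials n" using IH(1) by (auto simp: monomials_def)
    moreover have "(\<Sum>k=1..i. Poly_Mapping.lookup m k) \<le> (\<Sum>k=1..i. leading_exponent n w k)"
      if "i \<le> n" for i
    proof -
      have "(\<Sum>k=1..i. Poly_Mapping.lookup (m + Poly_Mapping.single ?a 1) k) =
          (\<Sum>k=1..i. Poly_Mapping.lookup m k) + (if ?a \<le> i then 1 else 0)"
        using a by (simp add: lookup_add sum.distrib lookup_single when_def)
      moreover have "(\<Sum>k=1..i. leading_exponent n (w \<circ> transpose ?a b) k) =
          (\<Sum>k=1..i. leading_exponent n w k) + (if larger_before w b + 1 \<le> i then 1 else 0)"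
        by (simp add: leading_exponent_climb[OF perm False refl b] sum.distrib)
      ultimately show ?thesis
        using IH(2)[OF that] larger_before_climb_ge[OF perm False refl b]
        by (simp split: if_splits)
    qed
    ultimately show ?thesis by blast
  qed
qed

text \<open>A link \<open>(a, b)\<close> of the chain lowers the weight at \<open>a\<close> by one,
  and by \<open>larger_before_leap\<close> row \<open>a\<close> is where the leap adds its
  box.\<close>

lemma leaping_chain_weight:
  assumes "w permutes {1..n}"
  shows "\<exists>C. is_leaping_chain n w C \<and> (\<forall>k\<in>{1..n}. weight n C k = int (leading_exponent n w k))"
  using assms
proof (induction w rule: permutes_induct_up)
  case (step w)
  show ?case
  proof (cases "w = longest_perm n")
    case True
    then show ?thesis
      using is_leaping_chain.longest[of n]
      by (intro exI[of _ "[]"]) (simp add: weight_def leading_exponent_longest)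
  next
    case False
    let ?a = "first_defect n w"
    obtain b where b: "leap n w = (?a, b)" "b \<in> climbs n w ?a"
      "\<forall>k. ?a < k \<and> k < b \<longrightarrow> w k < w ?a"
      by (rule leap_props[OF step.hyps False])
    obtain C where C: "is_leaping_chain n (w \<circ> transpose ?a b) C"
      "\<And>k. k \<in> {1..n} \<Longrightarrow> weight n C k = int (leading_exponent n (w \<circ> transpose ?a b) k)"
      using step.IH[OF climb_props[OF step.hyps False b(2)]] by blast
    have "weight n ((?a, b) # C) k = int (leading_exponent n w k)" if "k \<in> {1..n}" for k
      using C(2)[OF that] larger_before_leap[OF step.hyps False refl b(2,3)]
        leading_exponent_climb[OF step.hyps False refl b(2), of k]
      by (simp add: weight_def split: if_splits)
    then show ?thesis using is_leaping_chain.leap[OF False b(1) C(1)] by blast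
  qed
qed

definition leading_exponents :: "nat \<Rightarrow> (nat \<Rightarrow> nat) \<Rightarrow> monomial" where
  "leading_exponents n w = (\<Sum>k=1..n. Poly_Mapping.single k (leading_exponent n w k))"

lemma lookup_leading_exponents:
  "Poly_Mapping.lookup (leading_exponents n w) k = (if k \<in> {1..n} then leading_exponent n w k else 0)"
  by (simp add: leading_exponents_def lookup_sum_single)

text \<open>The leap contributes a positive coefficient by induction, and all other climbs
  contribute nonnegative ones.\<close>

lemma lookup_cotransition_poly_leading_pos:
  assumes "w permutes {1..n}"
  shows "0 < Poly_Mapping.lookup (cotransition_poly n w) (leading_exponents n w)"
  using assms
proof (induction w rule: permutes_induct_up)
  case (step w)
  note perm = step.hyps
  show ?case
  proof (cases "w = longest_perm n")
    case True
    then have "leading_exponents n w = (\<Sum>k=1..n. Poly_Mapping.single k (n - k))"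
      unfolding leading_exponents_def by (intro sum.cong) (simp_all add: leading_exponent_longest)
    then show ?thesis
      using True by (simp add: cotransition_poly_longest prod_x_var_power_eq_single)
  next
    case False
    let ?a = "first_defect n w" and ?m = "leading_exponents n w"
    let ?l = "\<lambda>b. Poly_Mapping.lookup (cotransition_poly n (w \<circ> transpose ?a b)) (?m + Poly_Mapping.single ?a 1)"
    obtain b where b: "leap n w = (?a, b)" "b \<in> climbs n w ?a"
      "\<forall>k. ?a < k \<and> k < b \<longrightarrow> w k < w ?a"
      by (rule leap_props[OF perm False])
    have "?m + Poly_Mapping.single ?a 1 = leading_exponents n (w \<circ> transpose ?a b)"
      using larger_before_leap[OF perm False refl b(2,3)] first_defect_in[OF perm False]
        leading_exponent_climb[OF perm False refl b(2)]
      by (intro poly_mapping_eqI) (auto simp: lookup_leading_exponents lookup_add lookup_single when_def)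
    then have "0 < ?l b"
      using step.IH[OF climb_props[OF perm False b(2)]] by (simp only:)
    then have "0 < (\<Sum>b\<in>climbs n w ?a. ?l b)"
      using b(2) climb_props(1)[OF perm False]
      by (intro sum_pos2[of _ b]) (auto intro: lookup_cotransition_poly_nonneg)
    then show ?thesis
      using perm False by (simp add: cotransition_poly.simps[of n w] lookup_divide_x_var lookup_sum)
  qed
qed

section \<open>Term orders refine dominance\<close>

lemma monomials_add: "p \<in> monomials n \<Longrightarrow> q \<in> monomials n \<Longrightarrow> p + q \<in> monomials n"
  using keys_add[of p q] by (auto simp: monomials_def)

lemma zero_in_monomials: "0 \<in> monomials n"
  by (simp add: monomials_def)

lemma single_in_monomials: "i \<in> {1..n} \<Longrightarrow> Poly_Mapping.single i d \<in> monomials n"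
  by (simp add: monomials_def)

lemma sum_in_monomials: "(\<And>i. i \<in> I \<Longrightarrow> p i \<in> monomials n) \<Longrightarrow> sum p I \<in> monomials n"
  by (induction I rule: infinite_finite_induct) (simp_all add: zero_in_monomials monomials_add)

context
  fixes n :: nat and R :: "monomial rel"
  assumes order: "term_order n R"
begin

lemma term_order_refl: "p \<in> monomials n \<Longrightarrow> (p, p) \<in> R"
  and term_order_trans: "(p, q) \<in> R \<Longrightarrow> (q, r) \<in> R \<Longrightarrow> (p, r) \<in> R"
  and term_order_antisym: "(p, q) \<in> R \<Longrightarrow> (q, p) \<in> R \<Longrightarrow> p = q"
  and term_order_total: "p \<in> monomials n \<Longrightarrow> q \<in> monomials n \<Longrightarrow> (p, q) \<in> R \<or> (q, p) \<in> R"
  and term_order_zero: "p \<in> monomials n \<Longrightarrow> (0, p) \<in> R"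
  and term_order_add: "(p, q) \<in> R \<Longrightarrow> r \<in> monomials n \<Longrightarrow> (p + r, q + r) \<in> R"
proof -
  have R: "refl_on (monomials n) R" "trans R" "antisym R" "total_on (monomials n) R"
    using order by (auto simp: term_order_def linear_order_on_def partial_order_on_def preorder_on_def)
  show "p \<in> monomials n \<Longrightarrow> (p, p) \<in> R" using R(1) by (rule refl_onD)
  show "(p, q) \<in> R \<Longrightarrow> (q, r) \<in> R \<Longrightarrow> (p, r) \<in> R" using R(2) by (rule transD)
  show "(p, q) \<in> R \<Longrightarrow> (q, p) \<in> R \<Longrightarrow> p = q" using R(3) by (rule antisymD)
  show "p \<in> monomials n \<Longrightarrow> q \<in> monomials n \<Longrightarrow> (p, q) \<in> R \<or> (q, p) \<in> R"
    using R(1,4) unfolding total_on_def by (metis refl_onD)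
  show "p \<in> monomials n \<Longrightarrow> (0, p) \<in> R"
    and "(p, q) \<in> R \<Longrightarrow> r \<in> monomials n \<Longrightarrow> (p + r, q + r) \<in> R"
    using order by (auto simp: term_order_def)
qed

lemma term_order_add_mono:
  assumes "(p, q) \<in> R" "(r, s) \<in> R" "r \<in> monomials n" "q \<in> monomials n"
  shows "(p + r, q + s) \<in> R"
  using term_order_add[OF assms(1,3)] term_order_add[OF assms(2,4)]
  by (auto simp: add.commute intro: term_order_trans)

lemma term_order_sum_mono:
  assumes "finite I" "\<And>i. i \<in> I \<Longrightarrow> (f i, g i) \<in> R"
    "\<And>i. i \<in> I \<Longrightarrow> f i \<in> monomials n" "\<And>i. i \<in> I \<Longrightarrow> g i \<in> monomials n"
  shows "(sum f I, sum g I) \<in> R"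
  using assms
  by (induction I rule: finite_induct)
    (simp_all add: term_order_refl zero_in_monomials term_order_add_mono sum_in_monomials)

text \<open>By totality the alternative is the reverse comparison; its translate forces equality by
  antisymmetry.\<close>

lemma term_order_cancel:
  assumes "(p + r, q + r) \<in> R" "p \<in> monomials n" "q \<in> monomials n" "r \<in> monomials n"
  shows "(p, q) \<in> R"
proof -
  consider "(p, q) \<in> R" | "(q, p) \<in> R" using term_order_total assms by blast
  then show ?thesis
  proof cases
    case 2
    then have "p + r = q + r" using term_order_add[OF 2 assms(4)] assms(1) term_order_antisym by blast
    then show ?thesis using assms term_order_refl by simp
  qed
qed

text \<open>With \<open>d i\<close> the excess of the partial sums of \<open>q\<close> over those of
  \<open>p\<close>, the quotient of \<open>q\<close> by \<open>p\<close> is the product of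
  \<open>(x_i / x_(i+1))^(d i)\<close> over \<open>i < n\<close>, times \<open>x_n^(d n)\<close>.
  Each factor is at least 1 in the order; \<open>g\<close> collects the numerators and
  \<open>f\<close> the denominators.\<close>

lemma term_order_dominance:
  assumes vars: "\<And>i j. 1 \<le> i \<Longrightarrow> i < j \<Longrightarrow> j \<le> n \<Longrightarrow>
      (Poly_Mapping.single j 1, Poly_Mapping.single i 1) \<in> R"
    and p: "p \<in> monomials n" and q: "q \<in> monomials n"
    and dom: "\<And>i. i \<le> n \<Longrightarrow>
      (\<Sum>k=1..i. Poly_Mapping.lookup p k) \<le> (\<Sum>k=1..i. Poly_Mapping.lookup q k)"
  shows "(p, q) \<in> R"
proof -
  let ?P = "\<lambda>i. \<Sum>k=1..i. Poly_Mapping.lookup p k" and ?Q = "\<lambda>i. \<Sum>k=1..i. Poly_Mapping.lookup q k"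
  define d where "d i = ?Q i - ?P i" for i
  \<comment> \<open>The last variable has no successor, so its power is compared with the monomial
    1.\<close>
  define f where "f i = (if i < n then Poly_Mapping.single (i + 1) (d i) else 0)" for i
  define g where "g i = Poly_Mapping.single i (d i)" for i
  have vars': "(Poly_Mapping.single (i + 1) e, Poly_Mapping.single i e) \<in> R"
    if "1 \<le> i" "i < n" for i e
  proof (induction e)
    case 0
    then show ?case by (simp add: term_order_refl zero_in_monomials)
  next
    case (Suc e)
    have "Poly_Mapping.single k (Suc e) = Poly_Mapping.single k 1 + Poly_Mapping.single k e" for k :: nat
      by (simp flip: single_add)
    then show ?case
      using vars[of i "i + 1"] Suc that
      by (simp only:) (intro term_order_add_mono single_in_monomials; simp)
  qed
  have mon: "f i \<in> monomials n" "g i \<in> monomials n" if "i \<in> {1..n}" for i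
    using that by (auto simp: f_def g_def zero_in_monomials single_in_monomials)
  have fg: "(sum f {1..n}, sum g {1..n}) \<in> R"
  proof (rule term_order_sum_mono)
    show "(f i, g i) \<in> R" if "i \<in> {1..n}" for i
      using that vars'[of i] mon(2)[OF that] by (auto simp: f_def g_def term_order_zero)
  qed (simp_all add: mon)
  have f0: "Poly_Mapping.lookup (sum f {1..n}) 0 = 0"
    by (simp add: f_def lookup_sum lookup_single_not_eq if_distrib[of "\<lambda>h. Poly_Mapping.lookup h 0"] cong: if_cong)
  have f_Suc: "Poly_Mapping.lookup (sum f {1..n}) (Suc k) = (if 1 \<le> k \<and> k < n then d k else 0)" for k
  proof -
    have "Poly_Mapping.lookup (f i) (Suc k) = (if i = k then if k < n then d k else 0 else 0)" for i
      by (auto simp: f_def lookup_single when_def)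
    then show ?thesis by (auto simp: lookup_sum)
  qed
  have g: "Poly_Mapping.lookup (sum g {1..n}) k = (if k \<in> {1..n} then d k else 0)" for k
    unfolding g_def by (rule lookup_sum_single) simp
  \<comment> \<open>Summation by parts.\<close>
  have "p + sum g {1..n} = q + sum f {1..n}"
  proof (rule poly_mapping_eqI)
    fix k
    show "Poly_Mapping.lookup (p + sum g {1..n}) k = Poly_Mapping.lookup (q + sum f {1..n}) k"
    proof (cases "k \<in> {1..n}")
      case True
      then obtain k' where k: "k = Suc k'" by (cases k) auto
      have "Poly_Mapping.lookup p k + d k = Poly_Mapping.lookup q k + d k'"
        using dom[of k] dom[of k'] True by (simp add: d_def k)
      moreover have "k' = 0 \<Longrightarrow> d k' = 0" by (simp add: d_def)
      ultimately show ?thesis using True unfolding lookup_add k g f_Suc by (cases "k' = 0") auto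
    next
      case False
      then have "Poly_Mapping.lookup p k = 0" "Poly_Mapping.lookup q k = 0"
        using p q by (auto simp: monomials_def in_keys_iff)
      moreover have "Poly_Mapping.lookup (sum f {1..n}) k = 0"
        using False f0 f_Suc by (cases k) auto
      ultimately show ?thesis using False unfolding lookup_add g by auto
    qed
  qed
  \<comment> \<open>Translating the comparison of \<open>f\<close> and \<open>g\<close> by
    \<open>p\<close> and rewriting its right side leaves the common summand
    \<open>sum f {1..n}\<close> to cancel.\<close>
  then have "(p + sum f {1..n}, q + sum f {1..n}) \<in> R"
    using term_order_add[OF fg p] by (simp add: add.commute)
  then show ?thesis
    by (rule term_order_cancel[OF _ p q sum_in_monomials[OF mon(1)]])
qed

end

theorem theorem11p8:
  fixes n :: nat and w :: "nat \<Rightarrow> nat" and R :: "monomial rel"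
  assumes "w permutes {1..n}"
    and "term_order n R"
    and "\<And>i j. 1 \<le> i \<Longrightarrow> i < j \<Longrightarrow> j \<le> n \<Longrightarrow>
           (Poly_Mapping.single j 1, Poly_Mapping.single i 1) \<in> R"
  shows "(\<forall>k\<in>{1..n}. weight n (leaping_chain n w) k \<ge> 0) \<and>
         is_leading_monomial R (schubert n w) (monomial_of n (weight n (leaping_chain n w)))"
proof
  obtain C where C: "is_leaping_chain n w C"
    "\<And>k. k \<in> {1..n} \<Longrightarrow> weight n C k = int (leading_exponent n w k)"
    using leaping_chain_weight[OF assms(1)] by blast
  have chain: "leaping_chain n w = C" by (rule leaping_chain_eqI[OF C(1)])
  have mon: "monomial_of n (weight n C) = leading_exponents n w"
    unfolding monomial_of_def leading_exponents_def by (intro sum.cong) (simp_all add: C(2))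
  show "\<forall>k\<in>{1..n}. weight n (leaping_chain n w) k \<ge> 0"
    by (simp add: chain C(2))
  show "is_leading_monomial R (schubert n w) (monomial_of n (weight n (leaping_chain n w)))"
    unfolding is_leading_monomial_def chain mon schubert_eq_cotransition_poly[OF assms(1)]
  proof (intro conjI ballI)
    show "leading_exponents n w \<in> Poly_Mapping.keys (cotransition_poly n w)"
      using lookup_cotransition_poly_leading_pos[OF assms(1)] by (simp add: in_keys_iff)
  next
    fix p assume "p \<in> Poly_Mapping.keys (cotransition_poly n w)"
    note p = keys_cotransition_poly_dominated[OF assms(1) this]
    show "(p, leading_exponents n w) \<in> R"
    proof (rule term_order_dominance[OF assms(2,3)])
      show "leading_exponents n w \<in> monomials n"
        unfolding leading_exponents_def by (intro sum_in_monomials single_in_monomials)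
      fix i assume "i \<le> n"
      moreover from this have "(\<Sum>k=1..i. Poly_Mapping.lookup (leading_exponents n w) k) =
          (\<Sum>k=1..i. leading_exponent n w k)"
        by (intro sum.cong) (simp_all add: lookup_leading_exponents)
      ultimately show "(\<Sum>k=1..i. Poly_Mapping.lookup p k) \<le>
          (\<Sum>k=1..i. Poly_Mapping.lookup (leading_exponents n w) k)"
        using p by simp
    qed (use p in auto)
  qed
qed

end
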